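(* Let $N\ge 6$ be an integer and $\alpha\in\{N^2,N(N+1)\}$. Then $g(h_\alpha)=\alpha-h_\alpha-C$, where $C=1$ if $\alpha=N^2$ and $N=2^l+1$ for some integer $l\ge1$; $C=3$ if $\alpha=N^2$ and $N\equiv 1 \pmod 3$, or if $\alpha=N(N+1)$ and $N\not\equiv 2\pmod 3$; $C=4$ if $\alpha=N^2$, $N\not\equiv 1\pmod 3$ and $N\neq 2^l+1$ for every integer $l\ge 1$; $C=5$ if $\alpha=N(N+1)$ and $N\equiv 2\pmod 3$.
   Context: A polyomino is a finite union of closed unit squares (tiles) of the square lattice, any two meeting (if at all) in a whole edge, whose interior is connected. Its holes are the bounded connected components of its complement in the plane; $h(A)$ is the number of holes of $A$ and $|A|$ its number of tiles. For $h\ge 1$, $g(h)=\min\{|A| : A \text{ a polyomino with } h(A)=h\}$. For a positive integer $N$ and $\alpha\in\{N^2, N(N+1)\}$, $h_\alpha$ denotes the maximum number of holes of a polyomino contained in the $N\times N$ square (if $\alpha=N^2$), respectively in the $N\times(N+1)$ rectangle (if $\alpha=N(N+1)$). *)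

theory Defs
  imports "HOL-Analysis.Analysis"
begin

text \<open>A cell (tile) of the square lattice is identified by the integer coordinates
  of its lower-left corner; the tile itself is the closed unit square.\<close>
type_synonym cell = "int \<times> int"

definition tile :: "cell \<Rightarrow> (real \<times> real) set" where
  "tile c = cbox (real_of_int (fst c), real_of_int (snd c))
                 (real_of_int (fst c) + 1, real_of_int (snd c) + 1)"

definition region :: "cell set \<Rightarrow> (real \<times> real) set" where
  "region A = \<Union> (tile ` A)"

definition polyomino :: "cell set \<Rightarrow> bool" where
  "polyomino A \<longleftrightarrow> finite A \<and> A \<noteq> {} \<and> connected (interior (region A))"

definition holes :: "cell set \<Rightarrow> nat" where
  "holes A = card {C \<in> components (- region A). bounded C}"

definition g :: "nat \<Rightarrow> nat" where
  "g h = (LEAST n. \<exists>A. polyomino A \<and> holes A = h \<and> card A = n)"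

definition hmax :: "nat \<Rightarrow> nat \<Rightarrow> nat" where
  "hmax w ht = Max {holes A | A. polyomino A \<and>
      A \<subseteq> {0..<int w} \<times> {0..<int ht}}"

definition h_alpha :: "nat \<Rightarrow> nat \<Rightarrow> nat" where
  "h_alpha N \<alpha> = (if \<alpha> = N^2 then hmax N N else hmax (N + 1) N)"

text \<open>The constant C of the theorem (the case conditions are mutually exclusive).\<close>
definition C_const :: "nat \<Rightarrow> nat \<Rightarrow> int" where
  "C_const N \<alpha> =
    (if \<alpha> = N^2 then
       (if \<exists>l::nat. l \<ge> 1 \<and> N = 2^l + 1 then 1
        else if N mod 3 = 1 then 3 else 4)
     else (if N mod 3 \<noteq> 2 then 3 else 5))"

end

theory Submission
  imports Defs
begin

text \<open>
  Bounding the perimeter of a polyomino with \<open>n\<close> tiles and \<open>k\<close> holes, which meets \<open>a\<close> columns and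
  \<open>b\<close> rows, gives \<open>2k + a + b \<le> n + 1\<close>; moreover \<open>n + k \<le> ab\<close>. So a \<open>w \<times> h\<close> rectangle has room for at
  most \<open>(w - 1)(h - 1)/3\<close> holes, and \<open>C\<close> is the deficit \<open>(w - 1)(h - 1) - 3k\<close> of the best
  polyomino. If that polyomino has only holes of one cell and leaves exactly \<open>C\<close> further cells empty,
  then the two inequalities also show that no polyomino with as many holes has fewer tiles.

  Modulo 3 only the deficits 0, 1 (squares) and 2 (rectangles) must be excluded. Keep one cell of each
  hole such that all other cells of the rectangle stay connected. By a spanning tree argument the cycle
  space of this graph has at most \<open>2^s\<close> elements, where \<open>s\<close> is the deficit; each set of interior lattice
  points that contains all or none of the corners of every hole gives a different element. For \<open>s = 0\<close> the
  empty and the full set are too many, for \<open>s = 2\<close> and an even side there are two lattice points that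
  touch no hole, and for \<open>s = 1\<close> all holes have even coordinate sum, the cells with two odd coordinates
  are holes, and the remaining holes form the same structure at half the scale, so that \<open>w - 1\<close> is a
  power of two.

  The extremal polyominoes arise from six small ones by adding three rows or three columns at a time,
  and by the doubling that inverts the halving step.
\<close>


text \<open>The factor 3 is an Euler count. Around \<open>k\<close> isolated one-cell holes the
  cells form a connected graph with \<open>w * h - k\<close> vertices and at most
  \<open>(w - 1) * h + w * (h - 1) - 4 * k\<close> edges, so at most
  \<open>(w - 1) * (h - 1) - 3 * k\<close> edges lie outside a spanning tree: this is the deficit.
  If \<open>C\<close> equals the deficit, the tile count \<open>n = w * h - k - C\<close> turns the
  first inequality into an equality for \<open>a = w\<close> and \<open>b = h\<close>, so the
  \<open>C\<close> extra empty cells use up all the slack. The obstacle is that a competitor for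
  \<open>g\<close> need not fit into the rectangle. Its bounding box is controlled only through the
  two inequalities, which suffices as long as \<open>C < h - 1\<close>; for the square of side 6
  this reads \<open>4 < 5\<close>. The factor also dictates the constructions. Three more rows raise
  \<open>(w - 1) * (h - 1)\<close> by \<open>3 * (w - 1)\<close>, so they must bring exactly
  \<open>w - 1\<close> new holes. Doubling the side \<open>m = w - 1\<close> of a square keeps the
  deficit if it brings \<open>m * m\<close> new holes, since
  \<open>4 * m * m = m * m + 3 * m * m\<close>.\<close>

section \<open>Connected sets of cells and their spanning trees\<close>

definition adj :: "cell \<Rightarrow> cell \<Rightarrow> bool" where
  "adj p q \<longleftrightarrow> (fst p = fst q \<and> \<bar>snd p - snd q\<bar> = 1) \<or> (snd p = snd q \<and> \<bar>fst p - fst q\<bar> = 1)"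

lemma adj_sym: "adj p q \<Longrightarrow> adj q p"
  by (auto simp: adj_def)

lemma adj_irrefl [simp]: "\<not> adj p p"
  by (auto simp: adj_def)

lemma adj_Pair [simp]: "adj (a, b) (c, d) \<longleftrightarrow> (a = c \<and> \<bar>b - d\<bar> = 1) \<or> (b = d \<and> \<bar>a - c\<bar> = 1)"
  by (simp add: adj_def)

lemma adj_cases:
  assumes "adj p q"
  obtains x y where "p = (x, y)" "q = (x + 1, y)"
  | x y where "p = (x + 1, y)" "q = (x, y)"
  | x y where "p = (x, y)" "q = (x, y + 1)"
  | x y where "p = (x, y + 1)" "q = (x, y)"
proof -
  obtain a b c d where pq: "p = (a, b)" "q = (c, d)" by (cases p, cases q)
  from assms consider "a = c" "d = b + 1" | "a = c" "b = d + 1" | "b = d" "c = a + 1" | "b = d" "a = c + 1"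
    unfolding pq adj_def by fastforce
  then show ?thesis using that pq by cases auto
qed

definition steps :: "cell set \<Rightarrow> (cell \<times> cell) set" where
  "steps A = {(p, q). p \<in> A \<and> q \<in> A \<and> adj p q}"

definition conn :: "cell set \<Rightarrow> bool" where
  "conn A \<longleftrightarrow> (\<forall>p\<in>A. \<forall>q\<in>A. (p, q) \<in> (steps A)\<^sup>*)"

lemma steps_mono: "A \<subseteq> B \<Longrightarrow> steps A \<subseteq> steps B"
  by (auto simp: steps_def)

lemma steps_rtrancl_mono: "(p, q) \<in> (steps A)\<^sup>* \<Longrightarrow> A \<subseteq> B \<Longrightarrow> (p, q) \<in> (steps B)\<^sup>*"
  using rtrancl_mono[OF steps_mono] by blast

lemma steps_rtrancl_sym: "(p, q) \<in> (steps A)\<^sup>* \<Longrightarrow> (q, p) \<in> (steps A)\<^sup>*"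
proof -
  have "sym (steps A)" by (auto simp: sym_def steps_def adj_sym)
  then show "(p, q) \<in> (steps A)\<^sup>* \<Longrightarrow> (q, p) \<in> (steps A)\<^sup>*"
    using sym_rtrancl symD by fast
qed

lemma stepI: "p \<in> A \<Longrightarrow> q \<in> A \<Longrightarrow> adj p q \<Longrightarrow> (p, q) \<in> (steps A)\<^sup>*"
  by (auto simp: steps_def)

lemma connI:
  assumes "\<And>q. q \<in> A \<Longrightarrow> (q, r) \<in> (steps A)\<^sup>*"
  shows "conn A"
  unfolding conn_def using assms by (meson steps_rtrancl_sym rtrancl_trans)

text \<open>The induction principle through which connectivity is used below: \<open>P\<close> is
  any property that steps inside \<open>A\<close> preserve.\<close>

lemma conn_subset:
  assumes "conn A" "p \<in> A" "p \<in> P"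
    and "\<And>a b. a \<in> P \<Longrightarrow> a \<in> A \<Longrightarrow> b \<in> A \<Longrightarrow> adj a b \<Longrightarrow> b \<in> P"
  shows "A \<subseteq> P"
proof
  fix q assume "q \<in> A"
  then have "(p, q) \<in> (steps A)\<^sup>*" using assms by (auto simp: conn_def)
  then show "q \<in> P"
    by (induction rule: rtrancl_induct) (use assms in \<open>auto simp: steps_def\<close>)
qed

text \<open>Counterpart of \<open>conn_subset\<close>: the cells reachable from \<open>p\<close>
  form a closed part, so it suffices that no closed part is proper. Used where explicit paths would
  be awkward.\<close>

lemma conn_if_closed_full:
  assumes "\<And>P. P \<subseteq> A \<Longrightarrow> P \<noteq> {} \<Longrightarrow> (\<And>a b. a \<in> P \<Longrightarrow> b \<in> A \<Longrightarrow> adj a b \<Longrightarrow> b \<in> P) \<Longrightarrow> P = A"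
  shows "conn A"
  unfolding conn_def
proof (intro ballI)
  fix p q assume pq: "p \<in> A" "q \<in> A"
  have "{x \<in> A. (p, x) \<in> (steps A)\<^sup>*} = A"
  proof (rule assms)
    show "{x \<in> A. (p, x) \<in> (steps A)\<^sup>*} \<noteq> {}" using pq by blast
  next
    fix a b assume "a \<in> {x \<in> A. (p, x) \<in> (steps A)\<^sup>*}" "b \<in> A" "adj a b"
    then show "b \<in> {x \<in> A. (p, x) \<in> (steps A)\<^sup>*}"
      by (metis (mono_tags, lifting) mem_Collect_eq rtrancl_trans stepI)
  qed auto
  then show "(p, q) \<in> (steps A)\<^sup>*" using pq by blast
qed

text \<open>A breadth-first spanning tree: \<open>d\<close> is the distance from the root
  \<open>r\<close>, and \<open>f x\<close> is the last cell before \<open>x\<close> on a shortest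
  path.\<close>

lemma conn_parent:
  assumes "conn A" "r \<in> A"
  obtains f and d :: "cell \<Rightarrow> nat"
  where "\<And>x. x \<in> A - {r} \<Longrightarrow> f x \<in> A \<and> adj x (f x) \<and> d (f x) < d x"
proof -
  define d where "d x = (LEAST n. (r, x) \<in> steps A ^^ n)" for x
  have "\<exists>y. y \<in> A \<and> adj x y \<and> d y < d x" if x: "x \<in> A - {r}" for x
  proof -
    have "(r, x) \<in> (steps A)\<^sup>*" using assms x by (auto simp: conn_def)
    then obtain n where "(r, x) \<in> steps A ^^ n" using rtrancl_imp_relpow by blast
    then have L: "(r, x) \<in> steps A ^^ d x" unfolding d_def by (rule LeastI)
    with x obtain k where k: "d x = Suc k" by (cases "d x") auto
    with L obtain y where y: "(r, y) \<in> steps A ^^ k" "(y, x) \<in> steps A" by auto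
    have "d y \<le> k" unfolding d_def using y(1) by (rule Least_le)
    moreover have "y \<in> A" "adj x y" using y(2) by (auto simp: steps_def intro: adj_sym)
    ultimately show ?thesis using k by (intro exI[of _ y]) auto
  qed
  then obtain f where "\<And>x. x \<in> A - {r} \<Longrightarrow> f x \<in> A \<and> adj x (f x) \<and> d (f x) < d x"
    by metis
  then show ?thesis by (rule that)
qed

definition edges :: "cell set \<Rightarrow> cell set set" where
  "edges A = {{p, q} | p q. p \<in> A \<and> q \<in> A \<and> adj p q}"

lemma edges_eq:
  "edges A = (\<lambda>(x, y). {(x, y), (x + 1, y)}) ` {(x, y). (x, y) \<in> A \<and> (x + 1, y) \<in> A}
           \<union> (\<lambda>(x, y). {(x, y), (x, y + 1)}) ` {(x, y). (x, y) \<in> A \<and> (x, y + 1) \<in> A}" (is "_ = ?R")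
proof
  show "edges A \<subseteq> ?R"
  proof
    fix e assume "e \<in> edges A"
    then obtain p q where "e = {p, q}" "p \<in> A" "q \<in> A" "adj p q" by (auto simp: edges_def)
    from this(4) this(1-3) show "e \<in> ?R"
      by (cases rule: adj_cases) (fastforce simp: insert_commute)+
  qed
  show "?R \<subseteq> edges A" by (fastforce simp: edges_def)
qed

lemma finite_edges: "finite A \<Longrightarrow> finite (edges A)"
proof -
  assume "finite A"
  then have "finite (Pow A)" by simp
  moreover have "edges A \<subseteq> Pow A" by (auto simp: edges_def)
  ultimately show ?thesis by (rule rev_finite_subset)
qed

lemma card_edges_le:
  assumes "finite A"
  shows "card (edges A) \<le> card {(x, y). (x, y) \<in> A \<and> (x + 1, y) \<in> A} + card {(x, y). (x, y) \<in> A \<and> (x, y + 1) \<in> A}"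
proof -
  have fin: "finite {(x, y). (x, y) \<in> A \<and> (x + 1, y) \<in> A}" "finite {(x, y). (x, y) \<in> A \<and> (x, y + 1) \<in> A}"
    by (rule finite_subset[OF _ assms]; auto)+
  show ?thesis unfolding edges_eq
    by (rule order_trans[OF card_Un_le add_mono]) (use fin in \<open>auto intro: card_image_le\<close>)
qed

text \<open>Since \<open>d\<close> decreases towards the parent, two cells cannot be each other's
  parent; so a tree edge determines its child.\<close>

lemma inj_on_parent_edges:
  fixes d :: "cell \<Rightarrow> nat"
  assumes "\<And>x. x \<in> X \<Longrightarrow> d (f x) < d x"
  shows "inj_on (\<lambda>x. {x, f x}) X"
proof (rule inj_onI)
  fix x y assume xy: "x \<in> X" "y \<in> X" "{x, f x} = {y, f y}"
  show "x = y"
  proof (rule ccontr)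
    assume "x \<noteq> y"
    with xy(3) have "x = f y \<and> f x = y" unfolding doubleton_eq_iff by blast
    with assms[OF xy(1)] assms[OF xy(2)] show False by (metis less_asym)
  qed
qed

lemma conn_card_edges:
  assumes "finite A" "conn A" "A \<noteq> {}"
  shows "card A \<le> card (edges A) + 1"
proof -
  obtain r where r: "r \<in> A" using assms by auto
  obtain f and d :: "cell \<Rightarrow> nat" where f: "\<And>x. x \<in> A - {r} \<Longrightarrow> f x \<in> A \<and> adj x (f x) \<and> d (f x) < d x"
    using conn_parent[OF assms(2) r] by blast
  have "inj_on (\<lambda>x. {x, f x}) (A - {r})" using f by (intro inj_on_parent_edges[of _ d]) auto
  moreover have "(\<lambda>x. {x, f x}) ` (A - {r}) \<subseteq> edges A" using f unfolding edges_def by blast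
  ultimately have "card (A - {r}) \<le> card (edges A)"
    using finite_edges[OF assms(1)] by (rule card_inj_on_le)
  then show ?thesis using r assms(1) by simp
qed

section \<open>Counting tiles against holes, rows and columns\<close>

text \<open>A combinatorial stand-in for the topological holes, reduced to what counting uses:
  finiteness makes every ray leave \<open>C\<close>, and the neighbour condition makes it leave into
  \<open>A\<close>.\<close>

definition hole_family :: "cell set \<Rightarrow> cell set set \<Rightarrow> bool" where
  "hole_family A K \<longleftrightarrow>
     (\<forall>C\<in>K. C \<noteq> {} \<and> finite C \<and> C \<inter> A = {} \<and> (\<forall>p\<in>C. \<forall>q. adj p q \<longrightarrow> q \<in> C \<or> q \<in> A)) \<and>
     disjoint K"

lemma ray_exit:
  assumes "finite C" "(x, y) \<in> C" "(a, b) \<noteq> (0 :: int, 0 :: int)"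
  obtains n :: nat where "n \<ge> 1" "(x + int n * a, y + int n * b) \<notin> C"
    "\<And>m. m < n \<Longrightarrow> (x + int m * a, y + int m * b) \<in> C"
proof -
  let ?f = "\<lambda>n::nat. (x + int n * a, y + int n * b)"
  have "inj ?f" using assms(3) by (auto simp: inj_on_def)
  then have "infinite (range ?f)" using finite_imageD by blast
  then obtain n where "?f n \<notin> C" using assms(1) by (meson finite_subset image_subsetI)
  then have L: "?f (LEAST n. ?f n \<notin> C) \<notin> C" by (rule LeastI)
  have "(LEAST n. ?f n \<notin> C) \<noteq> 0" using L assms(2) by (intro notI) simp
  moreover have "\<And>m. m < (LEAST n. ?f n \<notin> C) \<Longrightarrow> ?f m \<in> C" using not_less_Least by blast
  ultimately show ?thesis using L that[of "LEAST n. ?f n \<notin> C"] by simp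
qed

lemma hole_ray:
  assumes "hole_family A K" "C \<in> K" "(x, y) \<in> C" "adj (0, 0) (a, b)"
  obtains n :: nat where "n \<ge> 1" "(x + int n * a, y + int n * b) \<in> A"
    "\<And>m. m < n \<Longrightarrow> (x + int m * a, y + int m * b) \<in> C"
proof -
  have ab: "(a, b) \<noteq> (0, 0)" using assms(4) by auto
  have fin: "finite C" using assms by (auto simp: hole_family_def)
  obtain n :: nat where n: "n \<ge> 1" "(x + int n * a, y + int n * b) \<notin> C"
    "\<And>m. m < n \<Longrightarrow> (x + int m * a, y + int m * b) \<in> C" using ray_exit[OF fin assms(3) ab] by metis
  obtain k where k: "n = Suc k" using n(1) by (cases n) auto
  have "adj (x + int k * a, y + int k * b) (x + int n * a, y + int n * b)"
    using assms(4) unfolding k by (auto simp: algebra_simps)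
  then have "(x + int n * a, y + int n * b) \<in> A"
    using assms(1,2) n(2) n(3)[of k] k unfolding hole_family_def by blast
  then show ?thesis using that n by blast
qed

lemma disjointD': "disjoint K \<Longrightarrow> C \<in> K \<Longrightarrow> D \<in> K \<Longrightarrow> p \<in> C \<Longrightarrow> p \<in> D \<Longrightarrow> C = D"
  by (meson disjointD disjoint_iff)

text \<open>One direction of the perimeter count. The cells of \<open>Q\<close> have a right
  neighbour in \<open>A\<close>; the last cell of a row (\<open>R1\<close>) has none, nor has a cell
  whose right neighbour is in a hole (\<open>R2\<close>). A last cell is never in \<open>R2\<close>,
  because a ray to the right out of the hole meets \<open>A\<close> again.\<close>

lemma card_right_neighbours:
  assumes "finite A" "hole_family A K"
  shows "card {(x, y). (x, y) \<in> A \<and> (x + 1, y) \<in> A} + card (snd ` A) + card K \<le> card A"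
proof -
  define Q where "Q = {(x, y). (x, y) \<in> A \<and> (x + 1, y) \<in> A}"
  define R1 where "R1 = {p \<in> A. \<forall>q\<in>A. snd q = snd p \<longrightarrow> fst q \<le> fst p}"
  define R2 where "R2 = {(x, y). (x, y) \<in> A \<and> (\<exists>C\<in>K. (x + 1, y) \<in> C)}"
  have sub: "Q \<subseteq> A" "R1 \<subseteq> A" "R2 \<subseteq> A" by (auto simp: Q_def R1_def R2_def)
  have fin: "finite Q" "finite R1" "finite R2" using sub assms(1) by (auto intro: finite_subset)
  have "Q \<inter> R1 = {}" by (force simp: Q_def R1_def)
  moreover have "Q \<inter> R2 = {}" using assms(2) by (auto simp: Q_def R2_def hole_family_def)
  moreover have "R1 \<inter> R2 = {}"
  proof (rule ccontr)
    assume "R1 \<inter> R2 \<noteq> {}"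
    then obtain x y C where xy: "(x, y) \<in> R1" "C \<in> K" "(x + 1, y) \<in> C" by (auto simp: R2_def)
    obtain n :: nat where "(x + 1 + int n * 1, y + int n * 0) \<in> A"
      using hole_ray[OF assms(2) xy(2,3), of 1 0] by auto
    then have "x + 1 + int n \<le> x" using xy(1) unfolding R1_def by force
    then show False by simp
  qed
  ultimately have "card Q + card R1 + card R2 = card (Q \<union> R1 \<union> R2)"
    using fin by (subst card_Un_disjoint; (subst card_Un_disjoint)?) (auto simp: Int_Un_distrib2)
  also have "\<dots> \<le> card A" using sub assms(1) by (intro card_mono) auto
  finally have 1: "card Q + card R1 + card R2 \<le> card A" .
  have "snd ` A \<subseteq> snd ` R1"
  proof
    fix y assume "y \<in> snd ` A"
    then have ne: "fst ` {q \<in> A. snd q = y} \<noteq> {}" by auto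
    have finr: "finite (fst ` {q \<in> A. snd q = y})" using assms(1) by simp
    from Max_in[OF finr ne] obtain q where q: "q \<in> A" "snd q = y" "fst q = Max (fst ` {q \<in> A. snd q = y})"
      by auto
    have "q \<in> R1" using q Max_ge[OF finr] by (auto simp: R1_def)
    then show "y \<in> snd ` R1" using q by auto
  qed
  then have 2: "card (snd ` A) \<le> card R1"
    by (meson card_image_le card_mono fin(2) finite_imageI le_trans)
  \<comment> \<open>A ray to the left from a cell of \<open>C\<close> ends in \<open>A\<close>
    directly left of a cell of \<open>C\<close>. As the holes are disjoint, this choice is
    injective.\<close>
  have "\<exists>p. p \<in> R2 \<and> (fst p + 1, snd p) \<in> C" if C: "C \<in> K" for C
  proof -
    obtain x y where "(x, y) \<in> C" using assms(2) C unfolding hole_family_def by fastforce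
    then obtain n :: nat where n: "n \<ge> 1" "(x + int n * -1, y + int n * 0) \<in> A"
      "\<And>m. m < n \<Longrightarrow> (x + int m * -1, y + int m * 0) \<in> C"
      using hole_ray[OF assms(2) C, of x y "-1" 0] by auto
    obtain k where k: "n = Suc k" using n(1) by (cases n) auto
    have "(x - int n + 1, y) \<in> C" using n(3)[of k] k by (simp add: algebra_simps)
    then show ?thesis using n(2) C by (intro exI[of _ "(x - int n, y)"]) (auto simp: R2_def)
  qed
  then obtain f where f: "\<And>C. C \<in> K \<Longrightarrow> f C \<in> R2 \<and> (fst (f C) + 1, snd (f C)) \<in> C" by metis
  have "inj_on f K"
    using f assms(2) unfolding inj_on_def hole_family_def by (metis disjointD')
  then have 3: "card K \<le> card R2" using f fin by (intro card_inj_on_le[of f]) auto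
  show ?thesis using 1 2 3 unfolding Q_def by simp
qed

lemma adj_swap [simp]: "adj (prod.swap p) (prod.swap q) \<longleftrightarrow> adj p q"
  by (auto simp: adj_def)

lemma hole_family_swap:
  assumes "hole_family A K"
  shows "hole_family (prod.swap ` A) ((`) prod.swap ` K)"
  unfolding hole_family_def
proof (intro conjI ballI)
  fix C' assume "C' \<in> (`) prod.swap ` K"
  then obtain C where C: "C \<in> K" "C' = prod.swap ` C" by auto
  note D = assms[unfolded hole_family_def, THEN conjunct1, rule_format, OF C(1)]
  show "C' \<noteq> {}" "finite C'" using D C by auto
  show "C' \<inter> prod.swap ` A = {}" using D C by auto
  fix p assume "p \<in> C'"
  then obtain p' where p': "p' \<in> C" "p = prod.swap p'" using C by auto
  show "\<forall>q. adj p q \<longrightarrow> q \<in> C' \<or> q \<in> prod.swap ` A"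
  proof (intro allI impI)
    fix q assume "adj p q"
    then have "adj p' (prod.swap q)" unfolding p' adj_def by auto
    then have "prod.swap q \<in> C \<or> prod.swap q \<in> A" using D p'(1) by blast
    then have "prod.swap (prod.swap q) \<in> C' \<or> prod.swap (prod.swap q) \<in> prod.swap ` A"
      unfolding C(2) by (blast intro: imageI)
    then show "q \<in> C' \<or> q \<in> prod.swap ` A" by simp
  qed
next
  show "disjoint ((`) prod.swap ` K)"
  proof (rule disjointI)
    fix C' D' assume "C' \<in> (`) prod.swap ` K" "D' \<in> (`) prod.swap ` K" "C' \<noteq> D'"
    then obtain C D where CD: "C \<in> K" "D \<in> K" "C \<noteq> D" "C' = prod.swap ` C" "D' = prod.swap ` D" by blast
    then have "C \<inter> D = {}" using assms unfolding hole_family_def by (blast dest: disjointD)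
    then have "prod.swap ` (C \<inter> D) = {}" by simp
    then show "C' \<inter> D' = {}" unfolding CD by (subst image_Int[symmetric]) auto
  qed
qed

lemma card_up_neighbours:
  assumes "finite A" "hole_family A K"
  shows "card {(x, y). (x, y) \<in> A \<and> (x, y + 1) \<in> A} + card (fst ` A) + card K \<le> card A"
proof -
  have inj: "inj (prod.swap :: cell \<Rightarrow> cell)" by simp
  have "{(x, y). (x, y) \<in> prod.swap ` A \<and> (x + 1, y) \<in> prod.swap ` A}
      = prod.swap ` {(x, y). (x, y) \<in> A \<and> (x, y + 1) \<in> A}" by force
  moreover have "snd ` prod.swap ` A = fst ` A" by force
  moreover have "card ((`) prod.swap ` K) = card K"
    by (rule card_image) (meson inj inj_image_eq_iff inj_onI)
  ultimately show ?thesis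
    using card_right_neighbours[of "prod.swap ` A", OF _ hole_family_swap[OF assms(2)]] assms(1)
    by (simp add: card_image)
qed

text \<open>Connectivity requires at least \<open>card A - 1\<close> adjacent pairs, whereas the two
  neighbour counts allow at most \<open>2 * card A\<close> minus one for each occupied row and
  column and two for each hole.\<close>

lemma hole_family_card_bound:
  assumes "finite A" "conn A" "A \<noteq> {}" "hole_family A K"
  shows "2 * card K + card (fst ` A) + card (snd ` A) \<le> card A + 1"
  using card_right_neighbours[OF assms(1,4)] card_up_neighbours[OF assms(1,4)]
    conn_card_edges[OF assms(1-3)] card_edges_le[OF assms(1)] by linarith

lemma hole_cell_between:
  assumes "hole_family A K" "C \<in> K" "(x, y) \<in> C"
  shows "\<exists>n\<ge>1. (x + int n, y) \<in> A" "\<exists>n\<ge>1. (x - int n, y) \<in> A"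
    "\<exists>n\<ge>1. (x, y + int n) \<in> A" "\<exists>n\<ge>1. (x, y - int n) \<in> A"
  using hole_ray[OF assms, of 1 0] hole_ray[OF assms, of "-1" 0]
    hole_ray[OF assms, of 0 1] hole_ray[OF assms, of 0 "-1"]
  by (simp; metis)+

text \<open>Rays from a hole cell meet \<open>A\<close> in its row and in its column, so one cell of
  each hole fits into the product of the occupied columns and rows without being a tile.\<close>

lemma hole_family_area_bound:
  assumes "finite A" "hole_family A K"
  shows "card A + card K \<le> card (fst ` A) * card (snd ` A)"
proof -
  have "\<exists>p. p \<in> C" if "C \<in> K" for C using that assms(2) by (auto simp: hole_family_def)
  then obtain f where f: "\<And>C. C \<in> K \<Longrightarrow> f C \<in> C" by metis
  have inj: "inj_on f K" using f assms(2) unfolding inj_on_def hole_family_def by (metis disjointD')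
  have sub: "f ` K \<subseteq> fst ` A \<times> snd ` A"
  proof
    fix p assume "p \<in> f ` K"
    then obtain C where C: "C \<in> K" "p \<in> C" using f by auto
    obtain x y where p: "p = (x, y)" by (cases p)
    from hole_cell_between[OF assms(2) C(1), of x y] C(2) p
    obtain n m where "(x + int n, y) \<in> A" "(x, y + int m) \<in> A" by auto
    then show "p \<in> fst ` A \<times> snd ` A" unfolding p by force
  qed
  have fin: "finite (fst ` A \<times> snd ` A)" using assms(1) by simp
  have disj: "A \<inter> f ` K = {}" using f assms(2) unfolding hole_family_def by blast
  have "A \<subseteq> fst ` A \<times> snd ` A" by force
  then have "card (A \<union> f ` K) \<le> card (fst ` A \<times> snd ` A)"
    using sub by (intro card_mono[OF fin]) (rule Un_least)
  moreover have "card (A \<union> f ` K) = card A + card (f ` K)"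
    by (rule card_Un_disjoint[OF assms(1) finite_subset[OF sub fin] disj])
  ultimately show ?thesis
    unfolding card_image[OF inj] card_cartesian_product by simp
qed


section \<open>Reduction to isolated one-cell holes in a rectangle\<close>

definition rect :: "int \<Rightarrow> int \<Rightarrow> cell set" where
  "rect w h = {0..<w} \<times> {0..<h}"

lemma mem_rect [simp]: "(x, y) \<in> rect w h \<longleftrightarrow> 0 \<le> x \<and> x < w \<and> 0 \<le> y \<and> y < h"
  by (auto simp: rect_def)

lemma finite_rect [simp]: "finite (rect w h)"
  by (simp add: rect_def)

text \<open>Every cell outside \<open>H\<close> counts as free here, whether it was a tile, an empty
  cell outside all holes, or another cell of a larger hole.\<close>

definition hole_grid :: "int \<Rightarrow> int \<Rightarrow> cell set \<Rightarrow> bool" where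
  "hole_grid w h H \<longleftrightarrow> H \<subseteq> {1..w - 2} \<times> {1..h - 2} \<and> (\<forall>p\<in>H. \<forall>q\<in>H. \<not> adj p q) \<and> conn (rect w h - H)"

text \<open>The lowest cell of each hole is kept. A walk upwards from a free cell stops only
  directly below the kept cell of some \<open>C\<close>, and the cell where it stops borders on
  \<open>C\<close> but lies lower than all of it, hence is a tile. So every free cell reaches
  \<open>A\<close> or the top row, and \<open>A\<close> itself is joined to the top row from a
  topmost tile.\<close>

lemma hole_grid_of_family:
  assumes A: "A \<subseteq> rect w h" "conn A" "A \<noteq> {}" and K: "hole_family A K"
  obtains H where "hole_grid w h H" "card H = card K"
proof -
  have "\<exists>p. p \<in> C \<and> (\<forall>q\<in>C. snd p \<le> snd q)" if "C \<in> K" for C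
  proof -
    have C: "finite (snd ` C)" "snd ` C \<noteq> {}" using that K by (auto simp: hole_family_def)
    from Min_in[OF C] obtain p where "p \<in> C" "snd p = Min (snd ` C)" by auto
    then show ?thesis using Min_le[OF C(1)] by (intro exI[of _ p]) auto
  qed
  then obtain f where f: "\<And>C. C \<in> K \<Longrightarrow> f C \<in> C" and fmin: "\<And>C q. C \<in> K \<Longrightarrow> q \<in> C \<Longrightarrow> snd (f C) \<le> snd q"
    by metis
  have disj: "C \<inter> A = {}" if "C \<in> K" for C using that K by (auto simp: hole_family_def)
  have closed: "q \<in> C \<or> q \<in> A" if "C \<in> K" "p \<in> C" "adj p q" for C p q
    using that K unfolding hole_family_def by blast
  have same: "C = D" if "C \<in> K" "D \<in> K" "p \<in> C" "p \<in> D" for C D p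
    using that K unfolding hole_family_def by (metis disjointD')
  define H where "H = f ` K"
  have inj: "inj_on f K" by (rule inj_onI) (metis f same)
  have HA: "H \<inter> A = {}" using f disj unfolding H_def by blast
  have int: "H \<subseteq> {1..w - 2} \<times> {1..h - 2}"
  proof
    fix p assume "p \<in> H"
    then obtain C where C: "C \<in> K" "p \<in> C" using f by (auto simp: H_def)
    obtain x y where p: "p = (x, y)" by (cases p)
    from hole_cell_between[OF K C(1), of x y] C(2) p obtain n1 n2 n3 n4 :: nat
      where "n1 \<ge> 1" "n2 \<ge> 1" "n3 \<ge> 1" "n4 \<ge> 1"
        "(x + int n1, y) \<in> rect w h" "(x - int n2, y) \<in> rect w h" "(x, y + int n3) \<in> rect w h" "(x, y - int n4) \<in> rect w h"
      using A(1) by blast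
    then show "p \<in> {1..w - 2} \<times> {1..h - 2}" unfolding p by auto
  qed
  have iso: "\<not> adj p q" if "p \<in> H" "q \<in> H" for p q
  proof
    assume pq: "adj p q"
    obtain C D where CD: "C \<in> K" "D \<in> K" "p = f C" "q = f D" using \<open>p \<in> H\<close> \<open>q \<in> H\<close> by (auto simp: H_def)
    have "q \<in> C" using closed[OF CD(1) _ pq] f CD HA \<open>q \<in> H\<close> by blast
    then have "C = D" using same CD f by blast
    then show False using pq CD by simp
  qed
  let ?F = "rect w h - H"
  have A_F: "A \<subseteq> ?F" using A(1) HA by blast
  have up: "\<exists>q. ((x, y), q) \<in> (steps ?F)\<^sup>* \<and> (q \<in> A \<or> snd q = h - 1)" if "(x, y) \<in> ?F" "n = nat (h - 1 - y)" for x y n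
    using that
  proof (induction n arbitrary: y)
    case 0
    then have "y = h - 1" by auto
    then show ?case by (intro exI[of _ "(x, y)"]) simp
  next
    case (Suc n)
    show ?case
    proof (cases "(x, y + 1) \<in> H")
      case True
      then obtain C where C: "C \<in> K" "(x, y + 1) = f C" by (auto simp: H_def)
      have "(x, y) \<in> C \<or> (x, y) \<in> A" using closed[OF C(1), of "(x, y + 1)" "(x, y)"] f[OF C(1), folded C(2)] by simp
      moreover have "(x, y) \<notin> C" using fmin[OF C(1), of "(x, y)"] C(2)[symmetric] by auto
      ultimately show ?thesis by (intro exI[of _ "(x, y)"]) simp
    next
      case False
      with Suc.prems have F: "(x, y + 1) \<in> ?F" by auto
      obtain q where q: "((x, y + 1), q) \<in> (steps ?F)\<^sup>*" "q \<in> A \<or> snd q = h - 1"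
      proof -
        have "n = nat (h - 1 - (y + 1))" using Suc.prems(2) by simp
        from Suc.IH[OF F this] that show ?thesis by blast
      qed
      have "((x, y), (x, y + 1)) \<in> (steps ?F)\<^sup>*" using Suc.prems(1) F by (intro stepI) auto
      with q show ?thesis by (meson rtrancl_trans)
    qed
  qed
  obtain a b where ab: "(a, b) \<in> A" "\<And>q. q \<in> A \<Longrightarrow> snd q \<le> b"
  proof -
    have "finite A" using A(1) by (rule finite_subset) simp
    then have C: "finite (snd ` A)" "snd ` A \<noteq> {}" using A(3) by auto
    from Max_in[OF C] obtain p where p: "p \<in> A" "snd p = Max (snd ` A)" by auto
    then have "snd q \<le> snd p" if "q \<in> A" for q using Max_ge[OF C(1)] that by simp
    then show ?thesis using p(1) by (intro that[of "fst p" "snd p"]) simp_all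
  qed
  \<comment> \<open>No kept cell lies above the topmost tile \<open>(a, b)\<close>, since each hole
    cell has a tile somewhere above it.\<close>
  have above: "(a, b + int m) \<in> ?F \<and> ((a, b + int m), (a, b)) \<in> (steps ?F)\<^sup>*" if "b + int m \<le> h - 1" for m
    using that
  proof (induction m)
    case 0
    then show ?case using ab(1) A_F by auto
  next
    case (Suc m)
    have "(a, b + int (Suc m)) \<notin> H"
    proof
      assume "(a, b + int (Suc m)) \<in> H"
      then obtain C where "C \<in> K" "(a, b + int (Suc m)) \<in> C" using f by (auto simp: H_def)
      then obtain k :: nat where "(a, b + int (Suc m) + int k) \<in> A" using hole_cell_between(3)[OF K] by blast
      then show False using ab(2) by fastforce
    qed
    then have F: "(a, b + int (Suc m)) \<in> ?F" using Suc by auto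
    then have "((a, b + int (Suc m)), (a, b + int m)) \<in> (steps ?F)\<^sup>*" using Suc by (intro stepI) auto
    moreover have "((a, b + int m), (a, b)) \<in> (steps ?F)\<^sup>*" using Suc by simp
    ultimately show ?case using F by (meson rtrancl_trans)
  qed
  have bh: "b \<le> h - 1" using ab(1) A(1) by auto
  have top_F: "(x, h - 1) \<in> ?F" if "0 \<le> x" "x < w" for x using that bh int ab(1) A(1) by fastforce
  have top: "((int m, h - 1), (0, h - 1)) \<in> (steps ?F)\<^sup>*" if "int m < w" for m
    using that
  proof (induction m)
    case (Suc m)
    then have "((int (Suc m), h - 1), (int m, h - 1)) \<in> (steps ?F)\<^sup>*"
      using top_F[of "int m"] top_F[of "int (Suc m)"] by (intro stepI) auto
    moreover have "((int m, h - 1), (0, h - 1)) \<in> (steps ?F)\<^sup>*" using Suc by simp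
    ultimately show ?case by (meson rtrancl_trans)
  qed simp
  have top': "(q, (0, h - 1)) \<in> (steps ?F)\<^sup>*" if q: "q \<in> ?F" "snd q = h - 1" for q
  proof -
    obtain x where x: "q = (x, h - 1)" using q(2) by (cases q) auto
    then show ?thesis using top[of "nat x"] q(1) by auto
  qed
  have atop: "((a, b), (0, h - 1)) \<in> (steps ?F)\<^sup>*"
  proof -
    have "(a, h - 1) \<in> ?F \<and> ((a, h - 1), (a, b)) \<in> (steps ?F)\<^sup>*" using above[of "nat (h - 1 - b)"] bh by simp
    then show ?thesis using top'[of "(a, h - 1)"] steps_rtrancl_sym rtrancl_trans snd_conv by metis
  qed
  have "conn ?F"
  proof (rule connI)
    fix q assume q: "q \<in> ?F"
    obtain p where p: "(q, p) \<in> (steps ?F)\<^sup>*" "p \<in> A \<or> snd p = h - 1"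
      using up[of "fst q" "snd q"] q by auto
    have pF: "p \<in> ?F" using p(1) q by (induction rule: rtrancl_induct) (auto simp: steps_def)
    from p(2) have "(p, (0, h - 1)) \<in> (steps ?F)\<^sup>*"
    proof
      assume "p \<in> A"
      then have "(p, (a, b)) \<in> (steps A)\<^sup>*" using A(2) ab(1) by (auto simp: conn_def)
      then show ?thesis using steps_rtrancl_mono[OF _ A_F] atop by (meson rtrancl_trans)
    qed (use top' pF in blast)
    with p(1) show "(q, (0, h - 1)) \<in> (steps ?F)\<^sup>*" by (meson rtrancl_trans)
  qed
  then have "hole_grid w h H" using int iso by (auto simp: hole_grid_def)
  moreover have "card H = card K" unfolding H_def by (rule card_image[OF inj])
  ultimately show ?thesis by (rule that)
qed

section \<open>Saturated point sets and the cycle space of the free cells\<close>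

text \<open>Lattice points are coded like cells: the cell \<open>(i, j)\<close> has the corners \<open>(i, j)\<close>, \<open>(i + 1, j)\<close>,
  \<open>(i, j + 1)\<close>, \<open>(i + 1, j + 1)\<close>.\<close>

definition saturated :: "cell set \<Rightarrow> cell set \<Rightarrow> bool" where
  "saturated H S \<longleftrightarrow> (\<forall>(i, j)\<in>H. ((i + 1, j) \<in> S \<longleftrightarrow> (i, j) \<in> S) \<and> ((i, j + 1) \<in> S \<longleftrightarrow> (i, j) \<in> S) \<and>
     ((i + 1, j + 1) \<in> S \<longleftrightarrow> (i, j) \<in> S))"

text \<open>Modulo 2 this is the sum of the 4-cycles of cells around the points of \<open>S\<close>.\<close>

definition coboundary :: "cell set \<Rightarrow> cell set set" where
  "coboundary S = {{(i, j), (i + 1, j)} | i j. ((i + 1, j) \<in> S) \<noteq> ((i + 1, j + 1) \<in> S)}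
     \<union> {{(i, j), (i, j + 1)} | i j. ((i, j + 1) \<in> S) \<noteq> ((i + 1, j + 1) \<in> S)}"

lemma coboundary_horizontal: "{(i, j), (i + 1, j)} \<in> coboundary S \<longleftrightarrow> ((i + 1, j) \<in> S) \<noteq> ((i + 1, j + 1) \<in> S)"
  by (auto simp: coboundary_def doubleton_eq_iff)

lemma coboundary_vertical: "{(i, j), (i, j + 1)} \<in> coboundary S \<longleftrightarrow> ((i, j + 1) \<in> S) \<noteq> ((i + 1, j + 1) \<in> S)"
  by (auto simp: coboundary_def doubleton_eq_iff)

lemma coboundary_at_cell:
  "{(i, j), (i + 1, j)} \<in> coboundary S \<longleftrightarrow> ((i + 1, j) \<in> S) \<noteq> ((i + 1, j + 1) \<in> S)"
  "{(i, j), (i - 1, j)} \<in> coboundary S \<longleftrightarrow> ((i, j) \<in> S) \<noteq> ((i, j + 1) \<in> S)"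
  "{(i, j), (i, j + 1)} \<in> coboundary S \<longleftrightarrow> ((i, j + 1) \<in> S) \<noteq> ((i + 1, j + 1) \<in> S)"
  "{(i, j), (i, j - 1)} \<in> coboundary S \<longleftrightarrow> ((i, j) \<in> S) \<noteq> ((i + 1, j) \<in> S)"
  using coboundary_horizontal[of i j S] coboundary_horizontal[of "i - 1" j S]
    coboundary_vertical[of i j S] coboundary_vertical[of i "j - 1" S]
  by (simp_all add: insert_commute)

lemma coboundary_adj: "{p, q} \<in> coboundary S \<Longrightarrow> adj p q"
  by (auto simp: coboundary_def doubleton_eq_iff)

lemma coboundary_doubleton: "e \<in> coboundary S \<Longrightarrow> \<exists>p q. e = {p, q} \<and> adj p q"
  by (fastforce simp: coboundary_def)

lemma adj_neighbour_cases:
  assumes "adj (i, j) q"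
  shows "q = (i + 1, j) \<or> q = (i - 1, j) \<or> q = (i, j + 1) \<or> q = (i, j - 1)"
  using assms by (cases q) auto

lemma coboundary_sym_diff:
  "{p, q} \<in> coboundary (sym_diff S T) \<longleftrightarrow> ({p, q} \<in> coboundary S) \<noteq> ({p, q} \<in> coboundary T)"
proof (cases "adj p q")
  case True
  then show ?thesis
    by (cases rule: adj_cases) (auto simp: coboundary_horizontal coboundary_vertical insert_commute)
next
  case False
  then show ?thesis using coboundary_adj by blast
qed

text \<open>Around the four corners of a cell, membership in \<open>S\<close> changes an even number
  of times, so an edge at \<open>p\<close> never comes alone.\<close>

lemma coboundary_even_degree:
  assumes "{p, q} \<in> coboundary S"
  obtains r where "r \<noteq> q" "{p, r} \<in> coboundary S"
proof -
  obtain i j where p: "p = (i, j)" by (cases p)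
  show ?thesis
    using adj_neighbour_cases[OF coboundary_adj[OF assms, unfolded p]]
      assms[unfolded p] coboundary_at_cell[of i j S]
      that[unfolded p, of "(i + 1, j)"] that[unfolded p, of "(i - 1, j)"]
      that[unfolded p, of "(i, j + 1)"] that[unfolded p, of "(i, j - 1)"]
    by (elim disjE) (simp_all, blast+)
qed

lemma coboundary_hole:
  assumes "saturated H S" "p \<in> H"
  shows "{p, q} \<notin> coboundary S"
proof
  assume q: "{p, q} \<in> coboundary S"
  obtain i j where p: "p = (i, j)" by (cases p)
  have "((i + 1, j) \<in> S \<longleftrightarrow> (i, j) \<in> S) \<and> ((i, j + 1) \<in> S \<longleftrightarrow> (i, j) \<in> S) \<and> ((i + 1, j + 1) \<in> S \<longleftrightarrow> (i, j) \<in> S)"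
    using assms unfolding saturated_def p by blast
  then show False
    using adj_neighbour_cases[OF coboundary_adj[OF q, unfolded p]] q[unfolded p] coboundary_at_cell[of i j S]
    by auto
qed

lemma coboundary_in_edges:
  assumes "saturated H S" "S \<subseteq> {1..w - 1} \<times> {1..h - 1}"
  shows "coboundary S \<subseteq> edges (rect w h - H)"
proof
  fix e assume e: "e \<in> coboundary S"
  then obtain p q where pq: "e = {p, q}" "adj p q" using coboundary_doubleton by blast
  have "{p, q} \<in> coboundary S" "{q, p} \<in> coboundary S" using e pq(1) by (simp_all add: insert_commute)
  then have "p \<notin> H" "q \<notin> H" using coboundary_hole[OF assms(1)] by blast+
  moreover have "p \<in> rect w h \<and> q \<in> rect w h" using pq(2) e[unfolded pq(1)] assms(2)
    by (cases rule: adj_cases) (auto simp: coboundary_horizontal coboundary_vertical insert_commute)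
  ultimately show "e \<in> edges (rect w h - H)" using pq unfolding edges_def by blast
qed

text \<open>An empty coboundary makes \<open>S\<close> invariant under the shift to the right, which
  a finite nonempty set is not.\<close>

lemma coboundary_empty:
  assumes "coboundary S = {}" "finite S"
  shows "S = {}"
proof (rule ccontr)
  assume "S \<noteq> {}"
  then obtain i j where ij: "(i, j) \<in> S" by auto
  have "(i + int n, j) \<in> S" for n
  proof (induction n)
    case (Suc n)
    then show ?case using coboundary_vertical[of "i + int n" "j - 1" S] assms(1) by (simp add: add_ac)
  qed (use ij in simp)
  then have "range (\<lambda>n. (i + int n, j)) \<subseteq> S" by auto
  moreover have "inj (\<lambda>n. (i + int n, j))" by (auto simp: inj_def)
  ultimately show False using assms(2) by (meson finite_imageD finite_subset infinite_UNIV_nat)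
qed

text \<open>Each hole lies off the border and destroys four edges, and isolation ensures that no
  edge is destroyed twice. The destroyed horizontal edges have their left ends in \<open>H\<close>
  or \<open>L\<close>, the vertical ones their lower ends in \<open>H\<close> or
  \<open>D\<close>.\<close>

lemma card_hole_grid_edges:
  assumes "hole_grid w h H" "w \<ge> 1" "h \<ge> 1"
  shows "int (card (edges (rect w h - H))) \<le> (w - 1) * h + w * (h - 1) - 4 * int (card H)"
proof -
  have H: "H \<subseteq> {1..w - 2} \<times> {1..h - 2}" and iso: "\<And>p q. p \<in> H \<Longrightarrow> q \<in> H \<Longrightarrow> \<not> adj p q"
    using assms(1) by (auto simp: hole_grid_def)
  have fin: "finite H" using H by (rule finite_subset) simp
  define L where "L = (\<lambda>(x, y). (x - 1, y)) ` H"
  define D where "D = (\<lambda>(x, y). (x, y - 1)) ` H"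
  have finLD: "finite L" "finite D" using fin by (auto simp: L_def D_def)
  have cards: "card L = card H" "card D = card H"
    unfolding L_def D_def by (auto intro!: card_image simp: inj_on_def)
  have HL: "H \<inter> L = {}" using iso unfolding L_def by fastforce
  have HD: "H \<inter> D = {}" using iso unfolding D_def by fastforce
  have memL: "(x, y) \<in> L \<longleftrightarrow> (x + 1, y) \<in> H" for x y unfolding L_def by force
  have memD: "(x, y) \<in> D \<longleftrightarrow> (x, y + 1) \<in> H" for x y unfolding D_def by force
  have "{(x, y). (x, y) \<in> rect w h - H \<and> (x + 1, y) \<in> rect w h - H} = {0..<w - 1} \<times> {0..<h} - (H \<union> L)"
    by (auto simp: memL)
  moreover have "H \<union> L \<subseteq> {0..<w - 1} \<times> {0..<h}" using H by (auto simp: L_def)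
  moreover have "card ({0..<w - 1} \<times> {0..<h}) = nat (w - 1) * nat h" by (simp add: card_cartesian_product)
  ultimately have 1: "int (card {(x, y). (x, y) \<in> rect w h - H \<and> (x + 1, y) \<in> rect w h - H}) = (w - 1) * h - 2 * int (card H)"
    using card_Diff_subset[of "H \<union> L" "{0..<w - 1} \<times> {0..<h}"] card_mono[of "{0..<w - 1} \<times> {0..<h}" "H \<union> L"]
      card_Un_disjoint[OF fin finLD(1) HL] cards fin finLD assms by (simp add: of_nat_diff)
  have "{(x, y). (x, y) \<in> rect w h - H \<and> (x, y + 1) \<in> rect w h - H} = {0..<w} \<times> {0..<h - 1} - (H \<union> D)"
    by (auto simp: memD)
  moreover have "H \<union> D \<subseteq> {0..<w} \<times> {0..<h - 1}" using H by (auto simp: D_def)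
  moreover have "card ({0..<w} \<times> {0..<h - 1}) = nat w * nat (h - 1)" by (simp add: card_cartesian_product)
  ultimately have 2: "int (card {(x, y). (x, y) \<in> rect w h - H \<and> (x, y + 1) \<in> rect w h - H}) = w * (h - 1) - 2 * int (card H)"
    using card_Diff_subset[of "H \<union> D" "{0..<w} \<times> {0..<h - 1}"] card_mono[of "{0..<w} \<times> {0..<h - 1}" "H \<union> D"]
      card_Un_disjoint[OF fin finLD(2) HD] cards fin finLD assms by (simp add: of_nat_diff)
  show ?thesis using card_edges_le[of "rect w h - H"] 1 2 by simp
qed

lemma saturated_sym_diff:
  assumes "saturated H S" "saturated H T"
  shows "saturated H (sym_diff S T)"
  using assms unfolding saturated_def by (auto split: prod.splits)

text \<open>The exponent bounds the number of edges outside a spanning tree \<open>T\<close>, and a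
  saturated set is determined by the part of its coboundary outside \<open>T\<close>: if two sets
  agree there, the coboundary of their symmetric difference lies in the tree, and a nonempty set of
  tree edges has a vertex of degree one.\<close>

theorem card_saturated:
  assumes grid: "hole_grid w h H" and wh: "w \<ge> 1" "h \<ge> 1"
  defines "V \<equiv> {1..w - 1} \<times> {1..h - 1}"
  shows "3 * int (card H) \<le> (w - 1) * (h - 1)"
    and "card {S. S \<subseteq> V \<and> saturated H S} \<le> 2 ^ nat ((w - 1) * (h - 1) - 3 * int (card H))"
proof -
  let ?F = "rect w h - H"
  have H: "H \<subseteq> {1..w - 2} \<times> {1..h - 2}" using grid by (auto simp: hole_grid_def)
  have finH: "finite H" using H by (rule finite_subset) simp
  have cF: "conn ?F" using grid by (simp add: hole_grid_def)
  have rF: "(0, 0) \<in> ?F" using H wh by auto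
  define r :: cell where "r = (0, 0)"
  obtain f and d :: "cell \<Rightarrow> nat" where f: "\<And>x. x \<in> ?F - {r} \<Longrightarrow> f x \<in> ?F \<and> adj x (f x) \<and> d (f x) < d x"
    using conn_parent[OF cF rF] unfolding r_def by blast
  define T where "T = (\<lambda>x. {x, f x}) ` (?F - {r})"
  have finE: "finite (edges ?F)" by (rule finite_edges) simp
  have TE: "T \<subseteq> edges ?F" using f unfolding T_def edges_def by blast
  have "card T = card (?F - {r})" unfolding T_def
    by (rule card_image, rule inj_on_parent_edges[of _ d]) (use f in blast)
  also have "\<dots> = card ?F - 1" using rF by (simp add: r_def)
  finally have "card T = card ?F - 1" .
  moreover have "card ?F \<ge> 1" using rF by (metis One_nat_def Suc_leI card_gt_0_iff empty_iff finite_Diff finite_rect)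
  moreover have "int (card ?F) = w * h - int (card H)"
  proof -
    have sub: "H \<subseteq> rect w h" using H by auto
    have "int (card (rect w h)) = w * h" using wh by (simp add: rect_def card_cartesian_product)
    then show ?thesis using card_Diff_subset[OF finH sub] card_mono[OF finite_rect sub] by (simp add: of_nat_diff)
  qed
  ultimately have cT: "int (card T) = w * h - int (card H) - 1" by simp
  have "int (card (edges ?F - T)) = int (card (edges ?F)) - int (card T)"
    using card_Diff_subset[OF finite_subset[OF TE finE] TE] card_mono[OF finE TE] by (simp add: of_nat_diff)
  then have cET: "int (card (edges ?F - T)) \<le> (w - 1) * (h - 1) - 3 * int (card H)"
    using card_hole_grid_edges[OF grid wh] cT by (simp add: algebra_simps)
  then show "3 * int (card H) \<le> (w - 1) * (h - 1)" by linarith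
  have finV: "finite V" by (simp add: V_def)
  have forest: "S = {}" if S: "S \<subseteq> V" "saturated H S" "coboundary S \<subseteq> T" for S
  proof -
    have "coboundary S = {}"
    proof (rule ccontr)
      assume ne: "coboundary S \<noteq> {}"
      define X where "X = {x \<in> ?F - {r}. {x, f x} \<in> coboundary S}"
      have finX: "finite (d ` X)" by (simp add: X_def)
      have "X \<noteq> {}" using ne S(3) unfolding X_def T_def by blast
      then have "d ` X \<noteq> {}" by simp
      \<comment> \<open>A deepest child \<open>x\<close> of a coboundary edge. The second edge at
        \<open>x\<close> would have to lead to a child of \<open>x\<close>, which is deeper
        still.\<close>
      from Max_in[OF finX this] obtain x where x: "x \<in> X" "d x = Max (d ` X)" by auto
      have xmax: "d y \<le> d x" if "y \<in> X" for y using x(2) Max_ge[OF finX] that by auto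
      have xe: "{x, f x} \<in> coboundary S" using x(1) by (simp add: X_def)
      obtain y where y: "y \<noteq> f x" "{x, y} \<in> coboundary S" by (rule coboundary_even_degree[OF xe])
      then obtain z where z: "z \<in> ?F - {r}" "{x, y} = {z, f z}" using S(3) unfolding T_def by blast
      then have "z = y \<and> f z = x" using y(1) unfolding doubleton_eq_iff by blast
      moreover have "z \<in> X" using z y(2) by (simp add: X_def)
      ultimately show False using f[OF z(1)] xmax[of z] by auto
    qed
    then show ?thesis using coboundary_empty S(1) finV finite_subset by blast
  qed
  have "inj_on (\<lambda>S. coboundary S - T) {S. S \<subseteq> V \<and> saturated H S}"
  proof (rule inj_onI)
    fix S S' assume S: "S \<in> {S. S \<subseteq> V \<and> saturated H S}" "S' \<in> {S. S \<subseteq> V \<and> saturated H S}"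
      "coboundary S - T = coboundary S' - T"
    have "coboundary (sym_diff S S') \<subseteq> T"
    proof
      fix e assume e: "e \<in> coboundary (sym_diff S S')"
      then obtain p q where "e = {p, q}" using coboundary_doubleton by blast
      with e have "(e \<in> coboundary S) \<noteq> (e \<in> coboundary S')" using coboundary_sym_diff by blast
      then show "e \<in> T" using S(3) by blast
    qed
    then have "sym_diff S S' = {}" using S by (intro forest saturated_sym_diff) auto
    then show "S = S'" by blast
  qed
  moreover have "(\<lambda>S. coboundary S - T) ` {S. S \<subseteq> V \<and> saturated H S} \<subseteq> Pow (edges ?F - T)"
    using coboundary_in_edges[of H _ w h] unfolding V_def by blast
  ultimately have "card {S. S \<subseteq> V \<and> saturated H S} \<le> card (Pow (edges ?F - T))"
    using finE by (intro card_inj_on_le) auto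
  also have "\<dots> = 2 ^ card (edges ?F - T)" using finE by (intro card_Pow) auto
  also have "\<dots> \<le> 2 ^ nat ((w - 1) * (h - 1) - 3 * int (card H))"
    using cET by (intro power_increasing) auto
  finally show "card {S. S \<subseteq> V \<and> saturated H S} \<le> 2 ^ nat ((w - 1) * (h - 1) - 3 * int (card H))" .
qed


section \<open>Excluding the deficits 0 and 2, and the structure at deficit 1\<close>

lemma swap_rect: "prod.swap ` rect w h = rect h w"
  by (auto simp: rect_def)

lemma steps_rtrancl_swap: "(p, q) \<in> (steps A)\<^sup>* \<Longrightarrow> (prod.swap p, prod.swap q) \<in> (steps (prod.swap ` A))\<^sup>*"
proof (induction rule: rtrancl_induct)
  case (step y z)
  then have "(prod.swap y, prod.swap z) \<in> (steps (prod.swap ` A))\<^sup>*"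
    by (intro stepI) (auto simp: steps_def simp del: swap_simp)
  with step show ?case by (meson rtrancl_trans)
qed simp

lemma conn_swap: "conn A \<Longrightarrow> conn (prod.swap ` A)"
  unfolding conn_def using steps_rtrancl_swap by blast

lemma hole_grid_swap:
  assumes "hole_grid w h H"
  shows "hole_grid h w (prod.swap ` H)"
proof -
  have "prod.swap ` (rect w h - H) = rect h w - prod.swap ` H"
    by (simp add: image_set_diff swap_rect)
  then have "conn (rect h w - prod.swap ` H)"
    using assms conn_swap unfolding hole_grid_def by metis
  then show ?thesis using assms unfolding hole_grid_def by (auto simp: adj_def)
qed

lemma hole_grid_mem:
  assumes "hole_grid w h H" "(x, y) \<in> H"
  shows "1 \<le> x \<and> x \<le> w - 2 \<and> 1 \<le> y \<and> y \<le> h - 2"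
  using assms by (auto simp: hole_grid_def)

lemma hole_grid_isolated:
  assumes "hole_grid w h H" "(x, y) \<in> H"
  shows "(x + 1, y) \<notin> H" "(x - 1, y) \<notin> H" "(x, y + 1) \<notin> H" "(x, y - 1) \<notin> H"
proof -
  have "\<not> adj (x, y) q" if "q \<in> H" for q using assms that by (auto simp: hole_grid_def)
  then show "(x + 1, y) \<notin> H" "(x - 1, y) \<notin> H" "(x, y + 1) \<notin> H" "(x, y - 1) \<notin> H" by fastforce+
qed

lemma saturated_interior:
  assumes "hole_grid w h H"
  shows "saturated H ({1..w - 1} \<times> {1..h - 1})"
  using hole_grid_mem[OF assms] unfolding saturated_def by fastforce

lemma saturated_empty: "saturated H {}"
  by (auto simp: saturated_def)

lemma saturated_singleton:
  assumes "(x, y) \<notin> H" "(x - 1, y) \<notin> H" "(x, y - 1) \<notin> H" "(x - 1, y - 1) \<notin> H"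
  shows "saturated H {(x, y)}"
proof -
  have "(i = x \<longrightarrow> j \<noteq> y) \<and> (i + 1 = x \<longrightarrow> j \<noteq> y) \<and> (i = x \<longrightarrow> j + 1 \<noteq> y) \<and> (i + 1 = x \<longrightarrow> j + 1 \<noteq> y)"
    if "(i, j) \<in> H" for i j
    using assms that by auto
  then show ?thesis by (fastforce simp: saturated_def)
qed

lemma card_saturated_family:
  assumes "hole_grid w h H" "w \<ge> 1" "h \<ge> 1"
    and "\<And>S. S \<in> X \<Longrightarrow> S \<subseteq> {1..w - 1} \<times> {1..h - 1} \<and> saturated H S"
  shows "card X \<le> 2 ^ nat ((w - 1) * (h - 1) - 3 * int (card H))"
proof -
  have "X \<subseteq> {S. S \<subseteq> {1..w - 1} \<times> {1..h - 1} \<and> saturated H S}" using assms(4) by blast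
  moreover have "finite {S. S \<subseteq> {1..w - 1} \<times> {1..h - 1} \<and> saturated H S}"
    by (rule finite_subset[of _ "Pow ({1..w - 1} \<times> {1..h - 1})"]) auto
  ultimately have "card X \<le> card {S. S \<subseteq> {1..w - 1} \<times> {1..h - 1} \<and> saturated H S}" by (intro card_mono)
  also note card_saturated(2)[OF assms(1-3)]
  finally show ?thesis .
qed

lemma hole_grid_deficit_pos:
  assumes "hole_grid w h H" "w \<ge> 2" "h \<ge> 2"
  shows "3 * int (card H) + 1 \<le> (w - 1) * (h - 1)"
proof (rule ccontr)
  let ?V = "{1..w - 1} \<times> {1..h - 1}"
  assume "\<not> ?thesis"
  then have 0: "(w - 1) * (h - 1) - 3 * int (card H) = 0" using card_saturated(1)[OF assms(1)] assms by simp
  have "card {{}, ?V} \<le> 2 ^ nat ((w - 1) * (h - 1) - 3 * int (card H))"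
    by (rule card_saturated_family) (use assms saturated_interior saturated_empty in auto)
  moreover have "?V \<noteq> {}" using assms by auto
  ultimately show False using 0 by (simp add: card_insert_if)
qed

text \<open>If holes of row \<open>y\<close> touched every abscissa from \<open>1\<close> to
  \<open>w - 1\<close>, they would be forced, from the left, to sit at \<open>1, 3, 5, ...\<close>;
  for even \<open>w\<close> the last would be at \<open>w - 1\<close>, where no hole is
  allowed.\<close>

lemma even_row_untouched:
  assumes grid: "hole_grid w h H" and w: "even w" "w \<ge> 2"
  obtains x where "1 \<le> x" "x \<le> w - 1" "(x, y) \<notin> H" "(x - 1, y) \<notin> H"
proof (rule ccontr)
  assume "\<not> thesis"
  with that have touched: "(x, y) \<in> H \<or> (x - 1, y) \<in> H" if "1 \<le> x" "x \<le> w - 1" for x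
    using that by blast
  have "2 * int k + 1 \<le> w - 1 \<longrightarrow> (2 * int k + 1, y) \<in> H" for k
  proof (induction k)
    case 0
    show ?case using touched[of 1] hole_grid_mem[OF grid, of 0 y] w by auto
  next
    case (Suc k)
    show ?case
    proof
      assume k: "2 * int (Suc k) + 1 \<le> w - 1"
      then have "(2 * int k + 1, y) \<in> H" using Suc by simp
      then have "(2 * int k + 2, y) \<notin> H" using hole_grid_isolated(1)[OF grid, of "2 * int k + 1" y] by (simp add: add.assoc)
      then show "(2 * int (Suc k) + 1, y) \<in> H" using touched[of "2 * int (Suc k) + 1"] k by (simp add: add_ac)
    qed
  qed
  note all = this
  obtain k where k: "w = 2 * k" using w by auto
  then have last: "2 * int (nat (k - 1)) + 1 = w - 1" using w by auto
  have "(w - 1, y) \<in> H" using all[of "nat (k - 1)"] unfolding last by simp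
  then show False using hole_grid_mem[OF grid] by fastforce
qed

text \<open>Lattice points of height \<open>1\<close> and \<open>h - 1\<close> can touch only holes
  of the rows \<open>1\<close> and \<open>h - 2\<close>, so on each of these lines some point
  touches no hole. These two points give four saturated sets, the full set is a fifth, but only
  \<open>2 ^ 2\<close> are possible.\<close>

lemma hole_grid_deficit_even:
  assumes grid: "hole_grid w h H" and w: "even w" "w \<ge> 4" and h: "h \<ge> 3"
  shows "3 * int (card H) + 2 \<noteq> (w - 1) * (h - 1)"
proof
  let ?V = "{1..w - 1} \<times> {1..h - 1}"
  assume eq: "3 * int (card H) + 2 = (w - 1) * (h - 1)"
  have out: "(x, y) \<notin> H" if "y \<le> 0 \<or> y \<ge> h - 1" for x y using hole_grid_mem[OF grid, of x y] that by auto
  obtain a where a: "1 \<le> a" "a \<le> w - 1" "(a, 1) \<notin> H" "(a - 1, 1) \<notin> H"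
    using even_row_untouched[OF grid, where y = 1] w by auto
  obtain b where b: "1 \<le> b" "b \<le> w - 1" "(b, h - 2) \<notin> H" "(b - 1, h - 2) \<notin> H"
    using even_row_untouched[OF grid, where y = "h - 2"] w by auto
  have sa: "saturated H {(a, 1)}" using a out by (intro saturated_singleton) auto
  have sb: "saturated H {(b, h - 1)}" using b out by (intro saturated_singleton) auto
  have ne: "(a, 1) \<noteq> (b, h - 1)" using h by simp
  then have "sym_diff {(a, 1)} {(b, h - 1)} = {(a, 1), (b, h - 1)}" by auto
  then have sab: "saturated H {(a, 1), (b, h - 1)}" using saturated_sym_diff[OF sa sb] by simp
  \<comment> \<open>A third lattice point, which separates the full set from the other four.\<close>
  define p where "p = (if a = 1 then 2 else 1 :: int, 1 :: int)"
  have p: "p \<in> ?V" "p \<noteq> (a, 1)" "p \<noteq> (b, h - 1)" using w h by (auto simp: p_def)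
  have Vne: "?V \<noteq> {}" "?V \<noteq> {(a, 1)}" "?V \<noteq> {(b, h - 1)}" "?V \<noteq> {(a, 1), (b, h - 1)}"
    using p by blast+
  have "card {{}, {(a, 1)}, {(b, h - 1)}, {(a, 1), (b, h - 1)}, ?V} \<le> 2 ^ nat ((w - 1) * (h - 1) - 3 * int (card H))"
    by (rule card_saturated_family)
      (use grid a b sa sb sab saturated_interior[OF grid] saturated_empty w h in auto)
  moreover have "card {{}, {(a, 1)}, {(b, h - 1)}, {(a, 1), (b, h - 1)}, ?V} = 5"
    using ne Vne[symmetric] by (simp add: card_insert_if doubleton_eq_iff del: Times_empty)
  moreover have "(w - 1) * (h - 1) - 3 * int (card H) = 2" using eq by simp
  ultimately show False by simp
qed

text \<open>Only the empty and the full set are saturated now. The points touched by holes of even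
  coordinate sum form a saturated set \<open>S\<close>, because two holes of different parity that
  share a corner would be adjacent. So \<open>S\<close> is everything.\<close>

lemma hole_grid_deficit_one:
  assumes grid: "hole_grid w h H" and wh: "w \<ge> 3" "h \<ge> 3"
    and eq: "3 * int (card H) + 1 = (w - 1) * (h - 1)"
  shows "\<And>x y. (x, y) \<in> H \<Longrightarrow> even (x + y)"
    and "\<And>x y. 1 \<le> x \<Longrightarrow> x \<le> w - 1 \<Longrightarrow> 1 \<le> y \<Longrightarrow> y \<le> h - 1 \<Longrightarrow>
        if even (x + y) then (x, y) \<in> H \<or> (x - 1, y - 1) \<in> H else (x - 1, y) \<in> H \<or> (x, y - 1) \<in> H"
proof -
  let ?V = "{1..w - 1} \<times> {1..h - 1}"
  have triv: "S = {} \<or> S = ?V" if S: "S \<subseteq> ?V" "saturated H S" for S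
  proof (rule ccontr)
    assume c: "\<not> (S = {} \<or> S = ?V)"
    have "card {{}, S, ?V} \<le> 2 ^ nat ((w - 1) * (h - 1) - 3 * int (card H))"
      by (rule card_saturated_family) (use grid S saturated_interior[OF grid] saturated_empty wh in auto)
    moreover have "?V \<noteq> {}" using wh by auto
    then have "card {{}, S, ?V} = 3" using c by (subst card_3_iff) blast
    moreover have "(w - 1) * (h - 1) - 3 * int (card H) = 1" using eq by simp
    ultimately show False by simp
  qed
  define S where "S = {(x, y) \<in> ?V. if even (x + y) then (x, y) \<in> H \<or> (x - 1, y - 1) \<in> H else (x - 1, y) \<in> H \<or> (x, y - 1) \<in> H}"
  have corners: "((i, j) \<in> S \<longleftrightarrow> even (i + j)) \<and> ((i + 1, j) \<in> S \<longleftrightarrow> even (i + j)) \<and> ((i, j + 1) \<in> S \<longleftrightarrow> even (i + j)) \<and>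
      ((i + 1, j + 1) \<in> S \<longleftrightarrow> even (i + j))" if ij: "(i, j) \<in> H" for i j
    using ij hole_grid_mem[OF grid ij] hole_grid_isolated[OF grid ij] unfolding S_def
    by simp
  have "saturated H S" using corners unfolding saturated_def by auto
  moreover have "S \<subseteq> ?V" by (auto simp: S_def)
  \<comment> \<open>The point \<open>(1, 1)\<close> can touch only the hole \<open>(1, 1)\<close>;
    without that hole its singleton would be a third saturated set.\<close>
  moreover have "S \<noteq> {}"
  proof -
    have "(2, 1) \<in> ?V" using wh by auto
    have "?V \<noteq> {(1, 1)}"
    proof
      assume "?V = {(1, 1)}"
      with \<open>(2, 1) \<in> ?V\<close> have "(2, 1) \<in> {(1 :: int, 1 :: int)}" by (simp only:)
      then show False by simp
    qed
    then have "\<not> saturated H {(1, 1)}" using triv[of "{(1, 1)}"] wh by auto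
    then have "(1, 1) \<in> H" using saturated_singleton[of 1 1 H] hole_grid_mem[OF grid] by fastforce
    then show ?thesis using corners[of 1 1] by auto
  qed
  ultimately have SV: "S = ?V" using triv by blast
  show "even (x + y)" if "(x, y) \<in> H" for x y
    using corners[OF that] hole_grid_mem[OF grid that] SV by auto
  show "if even (x + y) then (x, y) \<in> H \<or> (x - 1, y - 1) \<in> H else (x - 1, y) \<in> H \<or> (x, y - 1) \<in> H"
    if "1 \<le> x" "x \<le> w - 1" "1 \<le> y" "y \<le> h - 1" for x y
  proof -
    have "(x, y) \<in> S" using SV that by auto
    then show ?thesis by (simp add: S_def)
  qed
qed


section \<open>Halving a square of deficit 1\<close>

text \<open>Each interior lattice point touches a hole, and all holes have even coordinate sum. A
  free cell with two odd coordinates therefore has holes at all four diagonal neighbours, and such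
  cells together with their free neighbours would be cut off from the origin. So these cells are all
  holes, and the remaining holes have two even coordinates.\<close>

lemma hole_grid_square_halve:
  assumes grid: "hole_grid (m + 1) (m + 1) H" and m: "m \<ge> 2" and eq: "3 * int (card H) + 1 = m * m"
  obtains n H' where "m = 2 * n" "hole_grid (n + 1) (n + 1) H'" "3 * int (card H') + 1 = n * n"
proof -
  let ?F = "rect (m + 1) (m + 1) - H"
  have eq': "3 * int (card H) + 1 = (m + 1 - 1) * (m + 1 - 1)" using eq by simp
  have ev: "even (x + y)" if "(x, y) \<in> H" for x y
    by (rule hole_grid_deficit_one(1)[OF grid _ _ eq' that]) (use m in simp_all)
  have touch: "if even (x + y) then (x, y) \<in> H \<or> (x - 1, y - 1) \<in> H else (x - 1, y) \<in> H \<or> (x, y - 1) \<in> H"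
    if "1 \<le> x" "x \<le> m" "1 \<le> y" "y \<le> m" for x y
    by (rule hole_grid_deficit_one(2)[OF grid _ _ eq']) (use m that in simp_all)
  have mem: "1 \<le> x \<and> x \<le> m - 1 \<and> 1 \<le> y \<and> y \<le> m - 1" if "(x, y) \<in> H" for x y
    using hole_grid_mem[OF grid that] by simp
  have cF: "conn ?F" using grid by (simp add: hole_grid_def)
  have fin: "finite H" using grid by (auto simp: hole_grid_def intro: finite_subset)
  \<comment> \<open>The only hole that can touch the lattice point \<open>(m, 1)\<close>; its parity
    makes \<open>m\<close> even.\<close>
  have "(m - 1, 1) \<in> H" using touch[of m 1] mem[of m 1] mem[of m 0] mem[of "m - 1" 0] m
    by (auto split: if_splits)
  from ev[OF this] obtain n where n: "m = 2 * n" by auto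
  define Odd where "Odd = {(x, y) \<in> ?F. odd x \<and> odd y}"
  have diag: "(x + 1, y + 1) \<in> H \<and> (x - 1, y + 1) \<in> H \<and> (x + 1, y - 1) \<in> H \<and> (x - 1, y - 1) \<in> H"
    if "(x, y) \<in> Odd" for x y
  proof -
    have xy: "0 \<le> x" "x \<le> m" "0 \<le> y" "y \<le> m" "odd x" "odd y" "(x, y) \<notin> H" using that by (auto simp: Odd_def)
    have "x \<noteq> 0" "y \<noteq> 0" "x \<noteq> m" "y \<noteq> m" using xy n by auto
    then have b: "1 \<le> x" "x + 1 \<le> m" "1 \<le> y" "y + 1 \<le> m" using xy by auto
    show ?thesis
      using touch[of x y] touch[of "x + 1" y] touch[of x "y + 1"] touch[of "x + 1" "y + 1"] b xy
        ev[of "x + 1" y] ev[of x "y + 1"] ev[of "x - 1" y] ev[of x "y - 1"] by auto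
  qed
  define W where "W = Odd \<union> {c \<in> ?F. \<exists>p\<in>Odd. adj c p}"
  have W_closed: "b \<in> W" if aW: "a \<in> W" and bF: "b \<in> ?F" and ab: "adj a b" for a b
  proof (cases "a \<in> Odd")
    case True
    then show ?thesis using bF ab adj_sym unfolding W_def by blast
  next
    case False
    then obtain x y where xy: "(x, y) \<in> Odd" "adj a (x, y)" using aW unfolding W_def by auto
    obtain u v where b: "b = (u, v)" by (cases b)
    have par: "odd x" "odd y" using xy(1) by (auto simp: Odd_def)
    have "a = (x + 1, y) \<or> a = (x - 1, y) \<or> a = (x, y + 1) \<or> a = (x, y - 1)"
      using adj_neighbour_cases[OF adj_sym[OF xy(2)]] .
    then have "b = (x, y) \<or> b = (x + 2, y) \<or> b = (x - 2, y) \<or> b = (x, y + 2) \<or> b = (x, y - 2) \<or> b \<in> H"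
      using diag[OF xy(1)] ab
      by (elim disjE) (auto dest!: adj_neighbour_cases simp: algebra_simps)
    then have "odd u \<and> odd v" using bF par b by auto
    then have "b \<in> Odd" using bF b by (auto simp: Odd_def)
    then show ?thesis by (simp add: W_def)
  qed
  have "?F \<subseteq> ?F - W"
  proof (rule conn_subset[OF cF])
    show "(0, 0) \<in> ?F" using mem m by fastforce
    then show "(0, 0) \<in> ?F - W"
      by (auto simp: W_def Odd_def)
    show "b \<in> ?F - W" if "a \<in> ?F - W" "a \<in> ?F" "b \<in> ?F" "adj a b" for a b
      using W_closed[of b a] that adj_sym by blast
  qed
  moreover have "Odd \<subseteq> ?F" by (auto simp: Odd_def)
  ultimately have "Odd = {}" unfolding W_def by blast
  then have odd: "(x, y) \<in> H" if "0 \<le> x" "x \<le> m" "0 \<le> y" "y \<le> m" "odd x" "odd y" for x y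
    using that by (auto simp: Odd_def)
  define H' where "H' = {(i, j). (2 * i, 2 * j) \<in> H}"
  have H'mem: "1 \<le> i \<and> i \<le> n - 1 \<and> 1 \<le> j \<and> j \<le> n - 1" if "(i, j) \<in> H'" for i j
    using mem[of "2 * i" "2 * j"] that n by (auto simp: H'_def)
  have enclosed: False if c: "c \<in> ?F" "c \<noteq> (0, 0)" "\<And>q. adj c q \<Longrightarrow> q \<in> H" for c
  proof -
    have "?F \<subseteq> {c}" by (rule conn_subset[OF cF c(1)]) (use c in auto)
    moreover have "(0, 0) \<in> ?F" using mem m by fastforce
    ultimately show False using c by blast
  qed
  \<comment> \<open>The cell between the doubles of two adjacent cells of \<open>H'\<close> would be
    enclosed by these two holes and by two holes with odd coordinates.\<close>
  have iso1: False if "(i, j) \<in> H'" "(i + 1, j) \<in> H'" for i j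
  proof (rule enclosed[of "(2 * i + 1, 2 * j)"])
    have b: "1 \<le> i" "i \<le> n - 1" "1 \<le> j" "j \<le> n - 1" using H'mem[OF that(1)] by auto
    show "(2 * i + 1, 2 * j) \<in> ?F" using b n ev[of "2 * i + 1" "2 * j"] by auto
    show "(2 * i + 1, 2 * j) \<noteq> (0, 0)" using b by simp
    have "(2 * i, 2 * j) \<in> H" "(2 * i + 2, 2 * j) \<in> H" using that by (auto simp: H'_def algebra_simps)
    moreover have "(2 * i + 1, 2 * j + 1) \<in> H" "(2 * i + 1, 2 * j - 1) \<in> H" using b n by (auto intro!: odd)
    ultimately show "q \<in> H" if "adj (2 * i + 1, 2 * j) q" for q
      using adj_neighbour_cases[OF that] by (auto simp: add_ac)
  qed
  have iso2: False if "(i, j) \<in> H'" "(i, j + 1) \<in> H'" for i j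
  proof (rule enclosed[of "(2 * i, 2 * j + 1)"])
    have b: "1 \<le> i" "i \<le> n - 1" "1 \<le> j" "j \<le> n - 1" using H'mem[OF that(1)] by auto
    show "(2 * i, 2 * j + 1) \<in> ?F" using b n ev[of "2 * i" "2 * j + 1"] by auto
    show "(2 * i, 2 * j + 1) \<noteq> (0, 0)" using b by simp
    have "(2 * i, 2 * j) \<in> H" "(2 * i, 2 * j + 2) \<in> H" using that by (auto simp: H'_def algebra_simps)
    moreover have "(2 * i + 1, 2 * j + 1) \<in> H" "(2 * i - 1, 2 * j + 1) \<in> H" using b n by (auto intro!: odd)
    ultimately show "q \<in> H" if "adj (2 * i, 2 * j + 1) q" for q
      using adj_neighbour_cases[OF that] by (auto simp: add_ac)
  qed
  let ?F' = "rect (n + 1) (n + 1) - H'"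
  have F': "(i, j) \<in> ?F' \<longleftrightarrow> (2 * i, 2 * j) \<in> ?F" for i j by (auto simp: H'_def n)
  have conn': "conn ?F'"
  proof (rule conn_if_closed_full)
    fix P assume P: "P \<subseteq> ?F'" "P \<noteq> {}" and closed: "\<And>a b. a \<in> P \<Longrightarrow> b \<in> ?F' \<Longrightarrow> adj a b \<Longrightarrow> b \<in> P"
    \<comment> \<open>The doubles of \<open>P\<close> with their free neighbours. As all cells with
      two odd coordinates are holes, a step out of such a neighbour ends at the double of the same
      or of an adjacent cell.\<close>
    define Q where "Q = {c \<in> ?F. \<exists>i j. (i, j) \<in> P \<and> (c = (2 * i, 2 * j) \<or> adj c (2 * i, 2 * j))}"
    obtain i0 j0 where ij0: "(i0, j0) \<in> P" using P(2) by auto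
    have "?F \<subseteq> Q"
    proof (rule conn_subset[OF cF])
      show "(2 * i0, 2 * j0) \<in> ?F" using ij0 P(1) F' by blast
      then show "(2 * i0, 2 * j0) \<in> Q" using ij0 unfolding Q_def by blast
    next
      fix a b assume ab: "a \<in> Q" "a \<in> ?F" "b \<in> ?F" "adj a b"
      from ab(1) obtain i j where ij: "(i, j) \<in> P" "a = (2 * i, 2 * j) \<or> adj a (2 * i, 2 * j)"
        unfolding Q_def by blast
      from ij(2) show "b \<in> Q"
      proof
        assume "a = (2 * i, 2 * j)"
        then show ?thesis using ab ij(1) adj_sym unfolding Q_def by blast
      next
        assume "adj a (2 * i, 2 * j)"
        then have a: "a = (2 * i + 1, 2 * j) \<or> a = (2 * i - 1, 2 * j) \<or> a = (2 * i, 2 * j + 1) \<or> a = (2 * i, 2 * j - 1)"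
          using adj_neighbour_cases adj_sym by blast
        have b: "b = (2 * i, 2 * j) \<or> b = (2 * (i + 1), 2 * j) \<or> b = (2 * (i - 1), 2 * j) \<or> b = (2 * i, 2 * (j + 1)) \<or> b = (2 * i, 2 * (j - 1)) \<or>
            b = (2 * i + 1, 2 * j + 1) \<or> b = (2 * i - 1, 2 * j + 1) \<or> b = (2 * i + 1, 2 * j - 1) \<or> b = (2 * i - 1, 2 * j - 1)"
        proof -
          have "b = (fst a + 1, snd a) \<or> b = (fst a - 1, snd a) \<or> b = (fst a, snd a + 1) \<or> b = (fst a, snd a - 1)"
            by (rule adj_neighbour_cases) (use ab(4) in simp)
          with a show ?thesis by (elim disjE) simp_all
        qed
        have no_odd: "b \<noteq> (2 * k + 1, 2 * l + 1)" for k l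
          using ab(3) odd[of "2 * k + 1" "2 * l + 1"] by auto
        have "b \<noteq> (2 * i + 1, 2 * j + 1)" "b \<noteq> (2 * i - 1, 2 * j + 1)" "b \<noteq> (2 * i + 1, 2 * j - 1)" "b \<noteq> (2 * i - 1, 2 * j - 1)"
          using no_odd[of i j] no_odd[of "i - 1" j] no_odd[of i "j - 1"] no_odd[of "i - 1" "j - 1"] by (simp_all add: algebra_simps)
        with b have "b = (2 * i, 2 * j) \<or> b = (2 * (i + 1), 2 * j) \<or> b = (2 * (i - 1), 2 * j) \<or> b = (2 * i, 2 * (j + 1)) \<or> b = (2 * i, 2 * (j - 1))"
          by blast
        then have "\<exists>k l. b = (2 * k, 2 * l) \<and> ((k, l) = (i, j) \<or> adj (i, j) (k, l))"
          by (elim disjE) ((rule exI)+, rule conjI, assumption, simp)+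
        then obtain k l where kl: "b = (2 * k, 2 * l)" "(k, l) = (i, j) \<or> adj (i, j) (k, l)" by blast
        have "(k, l) \<in> ?F'" using ab(3) F' kl(1) by blast
        then have "(k, l) \<in> P" using kl(2) ij(1) closed by blast
        then show ?thesis using ab(3) kl(1) unfolding Q_def by blast
      qed
    qed
    have "?F' \<subseteq> P"
    proof
      fix p assume p: "p \<in> ?F'"
      obtain i j where ij: "p = (i, j)" by (cases p)
      have "(2 * i, 2 * j) \<in> Q" using p F' ij \<open>?F \<subseteq> Q\<close> by blast
      then obtain k l where kl: "(k, l) \<in> P" "(2 * i, 2 * j) = (2 * k, 2 * l) \<or> adj (2 * i, 2 * j) (2 * k, 2 * l)"
        unfolding Q_def by blast
      have "\<not> adj (2 * i, 2 * j) (2 * k, 2 * l)" by simp presburger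
      then have "(i, j) = (k, l)" using kl(2) by fastforce
      then show "p \<in> P" using kl(1) ij by (simp only:)
    qed
    then show "P = ?F'" using P(1) by blast
  qed
  have "hole_grid (n + 1) (n + 1) H'"
    unfolding hole_grid_def
  proof (intro conjI ballI)
    show "H' \<subseteq> {1..n + 1 - 2} \<times> {1..n + 1 - 2}" using H'mem by auto
    show "\<not> adj p q" if "p \<in> H'" "q \<in> H'" for p q
    proof
      assume "adj p q"
      then show False using that by (cases rule: adj_cases) (auto intro: iso1 iso2)
    qed
  qed (rule conn')
  \<comment> \<open>There are \<open>n * n\<close> holes with odd coordinates, and
    \<open>3 * (n * n + card H') + 1 = 4 * n * n\<close>.\<close>
  moreover have "3 * int (card H') + 1 = n * n"
  proof -
    let ?O = "(\<lambda>(i, j). (2 * i + 1, 2 * j + 1)) ` ({0..<n} \<times> {0..<n})" and ?E = "(\<lambda>(i, j). (2 * i, 2 * j)) ` H'"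
    have "H = ?O \<union> ?E"
    proof (intro equalityI subsetI)
      fix p assume p: "p \<in> H"
      obtain x y where xy: "p = (x, y)" by (cases p)
      show "p \<in> ?O \<union> ?E"
      proof (cases "even x")
        case True
        then obtain i j where "x = 2 * i" "y = 2 * j" using ev p xy by (metis evenE even_add)
        then show ?thesis using p xy by (force simp: H'_def)
      next
        case False
        then obtain i j where "x = 2 * i + 1" "y = 2 * j + 1" using ev p xy by (metis oddE even_add)
        then show ?thesis using p xy mem[of x y] n by force
      qed
    next
      fix p assume "p \<in> ?O \<union> ?E"
      then show "p \<in> H" using odd n by (auto simp: H'_def)
    qed
    moreover have "?O \<inter> ?E = {}" by (auto; presburger)
    moreover have "finite H'" by (rule finite_subset[of _ "{1..n - 1} \<times> {1..n - 1}"]) (use H'mem in auto)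
    moreover have "card ?O = nat n * nat n"
      by (subst card_image) (auto simp: inj_on_def card_cartesian_product)
    moreover have "card ?E = card H'" by (rule card_image) (auto simp: inj_on_def)
    ultimately have "card H = nat n * nat n + card H'" by (simp add: card_Un_disjoint)
    then have "int (card H) = n * n + int (card H')" using m n by simp
    then show ?thesis using eq n by (simp add: algebra_simps)
  qed
  ultimately show ?thesis using that n by blast
qed

lemma hole_grid_square_power_of_two:
  assumes "hole_grid (int m + 1) (int m + 1) H" "3 * int (card H) + 1 = int m * int m" "m \<ge> 1"
  shows "\<exists>k. m = 2 ^ k"
  using assms
proof (induction m arbitrary: H rule: less_induct)
  case (less m)
  show ?case
  proof (cases "m = 1")
    case True
    then show ?thesis by (intro exI[of _ 0]) simp
  next
    case False
    obtain n H' where n: "int m = 2 * n" "hole_grid (n + 1) (n + 1) H'" "3 * int (card H') + 1 = n * n"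
      using hole_grid_square_halve[OF less.prems(1) _ less.prems(2)] less.prems(3) False by auto
    then have n': "n = int (nat n)" "m = 2 * nat n" "nat n \<ge> 1" "nat n < m" using less.prems(3) by auto
    obtain k where "nat n = 2 ^ k" using less.IH[of "nat n" H'] n n' by auto
    then show ?thesis using n'(2) by (intro exI[of _ "Suc k"]) simp
  qed
qed


section \<open>From plane topology to sets of cells\<close>

lemma box_real_pair: "box (a, b) (c, d) = {a<..<c} \<times> {b<..<d}" for a b c d :: real
  by (auto simp: mem_box Basis_prod_def)

definition otile :: "cell \<Rightarrow> (real \<times> real) set" where
  "otile c = box (real_of_int (fst c), real_of_int (snd c)) (real_of_int (fst c) + 1, real_of_int (snd c) + 1)"

lemma mem_tile: "(u, v) \<in> tile (i, j) \<longleftrightarrow> of_int i \<le> u \<and> u \<le> of_int i + 1 \<and> of_int j \<le> v \<and> v \<le> of_int j + 1"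
  by (auto simp: tile_def cbox_Pair_eq)

lemma mem_otile: "(u, v) \<in> otile (i, j) \<longleftrightarrow> of_int i < u \<and> u < of_int i + 1 \<and> of_int j < v \<and> v < of_int j + 1"
  by (auto simp: otile_def box_real_pair)

definition centre :: "cell \<Rightarrow> real \<times> real" where
  "centre c = (real_of_int (fst c) + 1 / 2, real_of_int (snd c) + 1 / 2)"

lemma centre_in_otile: "centre c \<in> otile c"
  by (cases c) (simp add: centre_def mem_otile)

lemma closure_otile: "closure (otile c) = tile c"
proof -
  have "otile c \<noteq> {}" using centre_in_otile by blast
  then show ?thesis unfolding otile_def tile_def by (rule closure_box)
qed

lemma open_otile: "open (otile c)" and connected_otile: "connected (otile c)"
  by (simp_all add: otile_def open_box convex_connected)

lemma otile_subset_tile: "otile c \<subseteq> tile c"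
  using closure_otile closure_subset by blast

lemma otile_meets_tile: "p \<in> otile c \<Longrightarrow> p \<in> tile d \<Longrightarrow> d = c"
proof -
  assume p: "p \<in> otile c" "p \<in> tile d"
  obtain u v i j k l where e: "p = (u, v)" "c = (i, j)" "d = (k, l)" by (cases p, cases c, cases d)
  show "d = c" using p unfolding e mem_otile mem_tile by (simp; linarith)
qed

lemma otile_meets_region: "p \<in> otile c \<Longrightarrow> p \<in> region A \<Longrightarrow> c \<in> A"
  using otile_meets_tile unfolding region_def by blast

lemma otile_subset_region: "c \<in> A \<Longrightarrow> otile c \<subseteq> region A"
  using otile_subset_tile unfolding region_def by blast

lemma otile_disjoint_region: "c \<notin> A \<Longrightarrow> otile c \<subseteq> - region A"
  using otile_meets_region by blast

lemma point_in_tile: "(u, v) \<in> tile (\<lfloor>u\<rfloor>, \<lfloor>v\<rfloor>)"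
  by (simp add: mem_tile)

lemma open_meets_otile:
  assumes "open U" "p \<in> U" "p \<in> tile c"
  shows "U \<inter> otile c \<noteq> {}"
  using assms closure_otile open_Int_closure_eq_empty by blast

lemma closed_region: "finite A \<Longrightarrow> closed (region A)"
  unfolding region_def by (intro closed_Union) (auto simp: tile_def)

text \<open>The interior of two adjacent tiles. It carries connectedness across their common edge,
  both inside a region and, as it meets no other tile, inside a complement.\<close>

lemma open_domino:
  assumes "adj c d"
  obtains D where "open D" "connected D" "otile c \<subseteq> D" "otile d \<subseteq> D" "D \<subseteq> tile c \<union> tile d"
    "\<And>p b. p \<in> D \<Longrightarrow> p \<in> tile b \<Longrightarrow> b = c \<or> b = d"
proof -
  have hor: "\<exists>D. open D \<and> connected D \<and> otile (x, y) \<subseteq> D \<and> otile (x + 1, y) \<subseteq> D \<and> D \<subseteq> tile (x, y) \<union> tile (x + 1, y) \<and>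
    (\<forall>p b. p \<in> D \<longrightarrow> p \<in> tile b \<longrightarrow> b = (x, y) \<or> b = (x + 1, y))" for x y
  proof -
    define D where "D = box (real_of_int x, real_of_int y) (real_of_int x + 2, real_of_int y + 1)"
    have m: "(u, v) \<in> D \<longleftrightarrow> of_int x < u \<and> u < of_int x + 2 \<and> of_int y < v \<and> v < of_int y + 1" for u v
      by (auto simp: D_def box_real_pair)
    have "b = (x, y) \<or> b = (x + 1, y)" if "(u, v) \<in> D" "(u, v) \<in> tile b" for u v b
    proof -
      obtain k l where b: "b = (k, l)" by (cases b)
      have "x - 1 < k" "k < x + 2" "y - 1 < l" "l < y + 1" using that unfolding b m mem_tile by linarith+
      then show ?thesis unfolding b by auto
    qed
    then show ?thesis
      by (intro exI[of _ D]) (auto simp: D_def[symmetric] m mem_otile mem_tile, auto simp: D_def open_box convex_connected)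
  qed
  have ver: "\<exists>D. open D \<and> connected D \<and> otile (x, y) \<subseteq> D \<and> otile (x, y + 1) \<subseteq> D \<and> D \<subseteq> tile (x, y) \<union> tile (x, y + 1) \<and>
    (\<forall>p b. p \<in> D \<longrightarrow> p \<in> tile b \<longrightarrow> b = (x, y) \<or> b = (x, y + 1))" for x y
  proof -
    define D where "D = box (real_of_int x, real_of_int y) (real_of_int x + 1, real_of_int y + 2)"
    have m: "(u, v) \<in> D \<longleftrightarrow> of_int x < u \<and> u < of_int x + 1 \<and> of_int y < v \<and> v < of_int y + 2" for u v
      by (auto simp: D_def box_real_pair)
    have "b = (x, y) \<or> b = (x, y + 1)" if "(u, v) \<in> D" "(u, v) \<in> tile b" for u v b
    proof -
      obtain k l where b: "b = (k, l)" by (cases b)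
      have "x - 1 < k" "k < x + 1" "y - 1 < l" "l < y + 2" using that unfolding b m mem_tile by linarith+
      then show ?thesis unfolding b by auto
    qed
    then show ?thesis
      by (intro exI[of _ D]) (auto simp: D_def[symmetric] m mem_otile mem_tile, auto simp: D_def open_box convex_connected)
  qed
  from assms show ?thesis
  proof (cases rule: adj_cases)
    case (1 x y)
    then show ?thesis using hor[of x y] that by blast
  next
    case (2 x y)
    then show ?thesis using hor[of y x] hor[of x y] that by blast
  next
    case (3 x y)
    then show ?thesis using ver[of x y] that by blast
  next
    case (4 x y)
    then show ?thesis using ver[of x y] that by blast
  qed
qed

text \<open>Open dominoes join the centres of adjacent tiles. An interior point may lie on an edge
  or a corner, but its component is open and therefore meets an open tile.\<close>

lemma connected_interior_region:
  assumes "conn A"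
  shows "connected (interior (region A))"
proof -
  let ?I = "interior (region A)"
  have otile_I: "otile c \<subseteq> ?I" if "c \<in> A" for c
    using otile_subset_region[OF that] open_otile by (rule interior_maximal)
  have step: "connected_component ?I (centre c) (centre d)" if cd: "c \<in> A" "d \<in> A" "adj c d" for c d
  proof -
    obtain D where D: "open D" "connected D" "otile c \<subseteq> D" "otile d \<subseteq> D" "D \<subseteq> tile c \<union> tile d"
      using open_domino[OF cd(3)] by metis
    have "D \<subseteq> region A" using D(5) cd unfolding region_def by blast
    then have "D \<subseteq> ?I" using D(1) by (rule interior_maximal)
    then show ?thesis using D centre_in_otile unfolding connected_component_def by blast
  qed
  have all: "connected_component ?I (centre c) (centre d)" if "c \<in> A" "d \<in> A" for c d
  proof -
    have "(c, d) \<in> (steps A)\<^sup>*" using assms that by (auto simp: conn_def)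
    then show ?thesis
    proof (induction rule: rtrancl_induct)
      case base
      then show ?case using that otile_I centre_in_otile connected_component_refl by blast
    next
      case (step y z)
      then show ?case using \<open>\<And>d c. \<lbrakk>c \<in> A; d \<in> A; adj c d\<rbrakk> \<Longrightarrow> connected_component ?I (centre c) (centre d)\<close>
        unfolding steps_def by (blast intro: connected_component_trans)
    qed
  qed
  have to_centre: "\<exists>c\<in>A. connected_component ?I p (centre c)" if p: "p \<in> ?I" for p
  proof -
    let ?C = "connected_component_set ?I p"
    have oC: "open ?C" by (rule open_connected_component) simp
    have pC: "p \<in> ?C" using p by simp
    obtain c where "p \<in> tile c" using point_in_tile by (cases p) blast
    with oC pC obtain q where q: "q \<in> ?C" "q \<in> otile c" using open_meets_otile by blast
    then have "q \<in> region A" using connected_component_subset interior_subset by blast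
    then have c: "c \<in> A" using q(2) otile_meets_region by blast
    have "connected_component ?I q (centre c)"
      unfolding connected_component_def using otile_I[OF c] connected_otile centre_in_otile q(2) by blast
    then show ?thesis using q(1) c by (meson connected_component_trans mem_Collect_eq)
  qed
  show ?thesis
    unfolding connected_iff_connected_component
    using to_centre all by (meson connected_component_sym connected_component_trans)
qed

text \<open>A closed proper part \<open>P\<close> would split the interior into two closed pieces.
  Nonadjacent tiles of the two pieces can share only a corner; if that corner is interior, then the
  tile \<open>(i, l)\<close> at it also belongs to \<open>A\<close> and joins the two.\<close>

lemma conn_of_connected_interior:
  assumes fin: "finite A" and con: "connected (interior (region A))"
  shows "conn A"
proof (rule conn_if_closed_full)
  fix P assume P: "P \<subseteq> A" "P \<noteq> {}" and closed: "\<And>a b. a \<in> P \<Longrightarrow> b \<in> A \<Longrightarrow> adj a b \<Longrightarrow> b \<in> P"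
  let ?I = "interior (region A)" and ?Q = "A - P"
  show "P = A"
  proof (rule ccontr)
    assume "P \<noteq> A"
    then have Q: "?Q \<noteq> {}" using P(1) by blast
    have cl: "closed (region P)" "closed (region ?Q)" using fin P(1) by (auto intro: closed_region finite_subset)
    have otile_I: "otile c \<subseteq> ?I" if "c \<in> A" for c
      using otile_subset_region[OF that] open_otile by (rule interior_maximal)
    have "region A = region P \<union> region ?Q" using P(1) unfolding region_def by blast
    then have cov: "?I \<subseteq> region P \<union> region ?Q" using interior_subset by blast
    have meets: "region X \<inter> ?I \<noteq> {}" if X: "X \<subseteq> A" "X \<noteq> {}" for X
    proof -
      obtain c where c: "c \<in> X" using X(2) by blast
      then have "centre c \<in> region X" "centre c \<in> ?I"
        using otile_subset_region[OF c] otile_I[of c] X(1) centre_in_otile[of c] by auto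
      then show ?thesis by blast
    qed
    have meetsPQ: "region P \<inter> ?I \<noteq> {}" "region ?Q \<inter> ?I \<noteq> {}"
      by (rule meets; use P Q in blast)+
    have "region P \<inter> region ?Q \<inter> ?I = {}"
    proof (rule ccontr)
      assume "region P \<inter> region ?Q \<inter> ?I \<noteq> {}"
      then obtain u v p q where pq: "p \<in> P" "q \<in> ?Q" "(u, v) \<in> tile p" "(u, v) \<in> tile q" "(u, v) \<in> ?I"
      proof -
        from \<open>region P \<inter> region ?Q \<inter> ?I \<noteq> {}\<close> obtain x p q
          where "p \<in> P" "q \<in> ?Q" "x \<in> tile p" "x \<in> tile q" "x \<in> ?I" unfolding region_def by blast
        then show ?thesis using that by (cases x) simp
      qed
      obtain i j k l where ij: "p = (i, j)" "q = (k, l)" by (cases p, cases q)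
      have b: "\<bar>i - k\<bar> \<le> 1" "\<bar>j - l\<bar> \<le> 1" using pq(3,4) unfolding ij mem_tile by linarith+
      have na: "\<not> adj p q" "p \<noteq> q" using closed pq(1,2) by blast+
      then have ne: "i \<noteq> k" "j \<noteq> l" using b unfolding ij by (simp; linarith)+
      have "(u, v) \<in> tile (i, l)" using pq(3,4) unfolding ij mem_tile by auto
      then have "?I \<inter> otile (i, l) \<noteq> {}" using pq(5) by (intro open_meets_otile) auto
      then have r: "(i, l) \<in> A" using otile_meets_region interior_subset by blast
      have "\<bar>i - k\<bar> = 1" "\<bar>j - l\<bar> = 1" using b ne by linarith+
      then have "adj p (i, l)" "adj (i, l) q" unfolding ij by auto
      then have "q \<in> P" using closed r pq(1,2) by blast
      then show False using pq(2) by blast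
    qed
    then show False using con cl cov meetsPQ unfolding connected_closed by blast
  qed
qed

lemma polyomino_iff: "polyomino A \<longleftrightarrow> finite A \<and> A \<noteq> {} \<and> conn A"
  unfolding polyomino_def using connected_interior_region conn_of_connected_interior by blast

lemma otile_subset_component:
  assumes "C \<in> components (- region A)" "otile c \<inter> C \<noteq> {}"
  shows "otile c \<subseteq> C"
proof -
  have "c \<notin> A" using assms otile_subset_region in_components_subset by blast
  then show ?thesis
    using components_maximal[OF assms(1) connected_otile otile_disjoint_region] assms(2) by blast
qed

text \<open>A bounded component is represented by the cells whose open tiles it meets, hence
  contains. Finiteness belongs to the conclusion because \<open>holes\<close> is a
  \<open>card\<close>, which would be \<open>0\<close> for an infinite set.\<close>

lemma holes_family:
  assumes "finite A"
  obtains K where "hole_family A K" "card K = holes A" "finite K" "finite {C \<in> components (- region A). bounded C}"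
proof -
  define Hs where "Hs = {C \<in> components (- region A). bounded C}"
  define cells where "cells C = {c. otile c \<inter> C \<noteq> {}}" for C
  have sub: "otile c \<subseteq> C" if "C \<in> Hs" "c \<in> cells C" for c C
    using that otile_subset_component unfolding Hs_def cells_def by blast
  have opn: "open C" if "C \<in> Hs" for C
    using that open_components[of "- region A" C] closed_region[OF assms] by (auto simp: Hs_def open_closed)
  have ne: "cells C \<noteq> {}" if C: "C \<in> Hs" for C
  proof -
    obtain u v where "(u, v) \<in> C" using in_components_nonempty C unfolding Hs_def by fastforce
    then have "C \<inter> otile (\<lfloor>u\<rfloor>, \<lfloor>v\<rfloor>) \<noteq> {}" using open_meets_otile[OF opn[OF C]] point_in_tile by blast
    then show ?thesis by (auto simp: cells_def)
  qed
  have disjA: "cells C \<inter> A = {}" if C: "C \<in> Hs" for C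
  proof -
    have "C \<subseteq> - region A" using C in_components_subset unfolding Hs_def by blast
    moreover have "centre c \<in> C" "c \<in> A \<Longrightarrow> centre c \<in> region A" if "c \<in> cells C" for c
      using sub[OF C that] otile_subset_region[of c A] centre_in_otile[of c] by auto
    ultimately show ?thesis by blast
  qed
  have fin: "finite (cells C)" if C: "C \<in> Hs" for C
  proof -
    obtain r where r: "\<And>p. p \<in> C \<Longrightarrow> norm p \<le> r" using C by (auto simp: Hs_def bounded_iff)
    have "c \<in> {- \<lceil>r\<rceil> - 1..\<lceil>r\<rceil>} \<times> {- \<lceil>r\<rceil> - 1..\<lceil>r\<rceil>}" if "c \<in> cells C" for c
    proof -
      obtain i j where c: "c = (i, j)" by (cases c)
      have "norm (centre c) \<le> r" using r sub[OF C that] centre_in_otile by blast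
      then have "\<bar>real_of_int i + 1 / 2\<bar> \<le> r" "\<bar>real_of_int j + 1 / 2\<bar> \<le> r"
        using norm_fst_le[of "real_of_int i + 1 / 2" "real_of_int j + 1 / 2"]
          norm_snd_le[of "real_of_int j + 1 / 2" "real_of_int i + 1 / 2"]
        by (auto simp: centre_def c)
      then show ?thesis unfolding c by (simp; linarith)
    qed
    then show ?thesis by (meson finite_SigmaI finite_atLeastAtMost_int finite_subset subsetI)
  qed
  have closed: "q \<in> cells C \<or> q \<in> A" if C: "C \<in> Hs" and p: "p \<in> cells C" and pq: "adj p q" for C p q
  proof (rule disjCI)
    assume q: "q \<notin> A"
    obtain D where D: "connected D" "otile p \<subseteq> D" "otile q \<subseteq> D"
      and Db: "\<And>x b. x \<in> D \<Longrightarrow> x \<in> tile b \<Longrightarrow> b = p \<or> b = q" using open_domino[OF pq] by metis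
    have "p \<notin> A" using disjA[OF C] p by blast
    then have "D \<subseteq> - region A" using Db q unfolding region_def by blast
    moreover have "C \<inter> D \<noteq> {}" using sub[OF C p] D(2) centre_in_otile by blast
    ultimately have "D \<subseteq> C" using components_maximal[OF _ D(1)] C unfolding Hs_def by blast
    then show "q \<in> cells C" using D(3) centre_in_otile unfolding cells_def by blast
  qed
  have same: "C = D" if "C \<in> Hs" "D \<in> Hs" "c \<in> cells C" "c \<in> cells D" for C D c
  proof -
    have "C \<inter> D \<noteq> {}" using sub that centre_in_otile by blast
    then show ?thesis using components_nonoverlap that unfolding Hs_def by blast
  qed
  have inj: "inj_on cells Hs" by (rule inj_onI) (use same ne in blast)
  have fam: "hole_family A (cells ` Hs)"
    unfolding hole_family_def
  proof (intro conjI ballI)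
    fix X assume "X \<in> cells ` Hs"
    then obtain C where C: "C \<in> Hs" "X = cells C" by blast
    show "X \<noteq> {}" "finite X" "X \<inter> A = {}" using ne fin disjA C by simp_all
    show "\<forall>q. adj p q \<longrightarrow> q \<in> X \<or> q \<in> A" if "p \<in> X" for p
      using closed[OF C(1)] that unfolding C(2) by blast
  next
    show "disjoint (cells ` Hs)"
    proof (rule disjointI)
      fix X Y assume "X \<in> cells ` Hs" "Y \<in> cells ` Hs" "X \<noteq> Y"
      then obtain C D where CD: "C \<in> Hs" "D \<in> Hs" "X = cells C" "Y = cells D" by blast
      then have "C \<noteq> D" using \<open>X \<noteq> Y\<close> by blast
      then show "X \<inter> Y = {}" using same[OF CD(1,2)] unfolding CD(3,4) by blast
    qed
  qed
  \<comment> \<open>All holes lie within the occupied columns and rows, so there are only finitely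
    many.\<close>
  have "cells ` Hs \<subseteq> Pow (fst ` A \<times> snd ` A)"
  proof
    fix X assume X: "X \<in> cells ` Hs"
    have "(x, y) \<in> fst ` A \<times> snd ` A" if xy: "(x, y) \<in> X" for x y
    proof -
      obtain n m :: nat where "(x + int n, y) \<in> A" "(x, y + int m) \<in> A"
        using hole_cell_between(1,3)[OF fam X xy] by blast
      then show ?thesis by force
    qed
    then show "X \<in> Pow (fst ` A \<times> snd ` A)" by auto
  qed
  then have finK: "finite (cells ` Hs)" using assms by (meson finite_Pow_iff finite_SigmaI finite_imageI finite_subset)
  have "card (cells ` Hs) = holes A" unfolding holes_def Hs_def[symmetric] by (rule card_image[OF inj])
  then show ?thesis using that[OF fam] finK finite_imageD[OF finK inj] unfolding Hs_def by blast
qed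

text \<open>The four neighbouring tiles cover the boundary of the tile, so a connected subset of the
  complement cannot leave the open tile.\<close>

lemma isolated_cell_component:
  assumes "c \<notin> A" "\<And>d. adj c d \<Longrightarrow> d \<in> A"
  shows "otile c \<in> components (- region A)"
  unfolding in_components_maximal
proof (intro conjI allI impI)
  show "otile c \<noteq> {}" using centre_in_otile by blast
  show "otile c \<subseteq> - region A" by (rule otile_disjoint_region[OF assms(1)])
  show "connected (otile c)" by (rule connected_otile)
  fix D assume D: "D \<noteq> {} \<and> otile c \<subseteq> D \<and> D \<subseteq> - region A \<and> connected D"
  obtain i j where c: "c = (i, j)" by (cases c)
  have "(u, v) \<in> region A" if "(u, v) \<in> tile c" "(u, v) \<notin> otile c" for u v
  proof -
    have "(u, v) \<in> tile (i - 1, j) \<or> (u, v) \<in> tile (i + 1, j) \<or> (u, v) \<in> tile (i, j - 1) \<or> (u, v) \<in> tile (i, j + 1)"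
      using that unfolding c mem_tile mem_otile by auto
    moreover have "(i - 1, j) \<in> A" "(i + 1, j) \<in> A" "(i, j - 1) \<in> A" "(i, j + 1) \<in> A"
      using assms(2) unfolding c by auto
    ultimately show ?thesis unfolding region_def by blast
  qed
  then have "D \<subseteq> otile c \<union> - tile c" using D by auto
  moreover have "open (- tile c)" unfolding tile_def by (intro open_Compl closed_cbox)
  moreover have "otile c \<inter> - tile c \<inter> D = {}" using otile_subset_tile by blast
  ultimately have "otile c \<inter> D = {} \<or> - tile c \<inter> D = {}"
    using D open_otile by (intro connectedD) auto
  then have "- tile c \<inter> D = {}" using D centre_in_otile by blast
  then show "D = otile c" using D \<open>D \<subseteq> otile c \<union> - tile c\<close> by blast
qed

lemma card_isolated_le_holes:
  assumes "finite A" "H \<inter> A = {}" "\<And>c d. c \<in> H \<Longrightarrow> adj c d \<Longrightarrow> d \<in> A"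
  shows "card H \<le> holes A"
proof -
  have "finite {C \<in> components (- region A). bounded C}" using holes_family[OF assms(1)] by metis
  moreover have "inj_on otile H"
    by (rule inj_onI) (metis centre_in_otile otile_meets_tile otile_subset_tile subsetD)
  moreover have "otile ` H \<subseteq> {C \<in> components (- region A). bounded C}"
  proof
    fix X assume "X \<in> otile ` H"
    then obtain c where c: "c \<in> H" "X = otile c" by blast
    have "bounded X" unfolding c(2) otile_def by simp
    then show "X \<in> {C \<in> components (- region A). bounded C}"
      using isolated_cell_component[of c A] c assms by blast
  qed
  ultimately show ?thesis unfolding holes_def by (intro card_inj_on_le)
qed


section \<open>Frames and their growth by three rows\<close>

lemma conn_remove:
  assumes "conn Z" "k \<in> Z" "\<And>q. q \<in> Z \<Longrightarrow> adj k q \<Longrightarrow> (q, r) \<in> (steps (Z - {k}))\<^sup>*"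
  shows "conn (Z - {k})"
proof (rule connI)
  fix q assume q: "q \<in> Z - {k}"
  have "Z \<subseteq> {q. q = k \<or> (q, r) \<in> (steps (Z - {k}))\<^sup>*}"
  proof (rule conn_subset[OF assms(1,2)])
    fix a b assume ab: "a \<in> {q. q = k \<or> (q, r) \<in> (steps (Z - {k}))\<^sup>*}" "a \<in> Z" "b \<in> Z" "adj a b"
    show "b \<in> {q. q = k \<or> (q, r) \<in> (steps (Z - {k}))\<^sup>*}"
    proof (cases "a = k \<or> b = k")
      case True
      then show ?thesis using assms(3) ab by blast
    next
      case False
      then have "(b, a) \<in> (steps (Z - {k}))\<^sup>*" using ab adj_sym by (intro stepI) auto
      moreover have "(a, r) \<in> (steps (Z - {k}))\<^sup>*" using False ab(1) by blast
      ultimately have "(b, r) \<in> (steps (Z - {k}))\<^sup>*" by (rule rtrancl_trans)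
      then show ?thesis by blast
    qed
  qed simp
  then show "(q, r) \<in> (steps (Z - {k}))\<^sup>*" using q by blast
qed

lemma steps_horizontal:
  assumes "\<And>x. a \<le> x \<Longrightarrow> x \<le> b \<Longrightarrow> (x, y) \<in> Z" "a \<le> x" "x \<le> b" "a \<le> x'" "x' \<le> b"
  shows "((x, y), (x', y)) \<in> (steps Z)\<^sup>*"
proof -
  have "((u, y), (a, y)) \<in> (steps Z)\<^sup>*" if "a \<le> u" "u \<le> b" for u
    using that
  proof (induction u rule: int_ge_induct)
    case (step u)
    then have "((u + 1, y), (u, y)) \<in> (steps Z)\<^sup>*" using assms(1) by (intro stepI) auto
    moreover have "((u, y), (a, y)) \<in> (steps Z)\<^sup>*" using step by simp
    ultimately show ?case by (rule rtrancl_trans)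
  qed simp
  then show ?thesis using assms by (meson rtrancl_trans steps_rtrancl_sym)
qed

lemma steps_vertical:
  assumes "\<And>y. a \<le> y \<Longrightarrow> y \<le> b \<Longrightarrow> (x, y) \<in> Z" "a \<le> y" "y \<le> b" "a \<le> y'" "y' \<le> b"
  shows "((x, y), (x, y')) \<in> (steps Z)\<^sup>*"
proof -
  have "((x, u), (x, a)) \<in> (steps Z)\<^sup>*" if "a \<le> u" "u \<le> b" for u
    using that
  proof (induction u rule: int_ge_induct)
    case (step u)
    then have "((x, u + 1), (x, u)) \<in> (steps Z)\<^sup>*" using assms(1) by (intro stepI) auto
    moreover have "((x, u), (x, a)) \<in> (steps Z)\<^sup>*" using step by simp
    ultimately show ?case by (rule rtrancl_trans)
  qed simp
  then show ?thesis using assms by (meson rtrancl_trans steps_rtrancl_sym)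
qed

text \<open>In a frame the holes next to the top row and to the rightmost column are exactly the cells
  of one parity. This makes it possible to add three rows (for even width) and, by symmetry, three
  columns (for even height) without changing the deficit \<open>D\<close>. \<open>B\<close> are cells left empty near the
  origin, and \<open>K\<close> is a set of cells near the origin that are no holes.\<close>

definition frame :: "int \<Rightarrow> int \<Rightarrow> int \<Rightarrow> cell set \<Rightarrow> cell set \<Rightarrow> int \<Rightarrow> cell set \<Rightarrow> bool" where
  "frame w h c B K D H \<longleftrightarrow> 4 \<le> w \<and> 4 \<le> h \<and>
     H \<subseteq> {1..w - 2} \<times> {1..h - 2} \<and> B \<subseteq> {0..w - 3} \<times> {0..h - 3} \<and> K \<subseteq> {0..2} \<times> {0..2} \<and> K \<inter> H = {} \<and>
     B \<inter> H = {} \<and> (\<forall>p\<in>H. \<forall>q. adj p q \<longrightarrow> q \<notin> H \<and> q \<notin> B) \<and> conn (rect w h - H - B) \<and>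
     (\<forall>x\<in>{1..w - 2}. (x, h - 2) \<in> H \<longleftrightarrow> even (x + (h - 2) + c)) \<and>
     (\<forall>y\<in>{1..h - 2}. (w - 2, y) \<in> H \<longleftrightarrow> even (w - 2 + y + c)) \<and>
     3 * int (card H) + D = (w - 1) * (h - 1)"

definition framed :: "int \<Rightarrow> int \<Rightarrow> int \<Rightarrow> cell set \<Rightarrow> cell set \<Rightarrow> int \<Rightarrow> bool" where
  "framed w h c B K D \<longleftrightarrow> (\<exists>H. frame w h c B K D H)"

lemma framed_swap:
  assumes "framed w h c B K D"
  shows "framed h w c (prod.swap ` B) (prod.swap ` K) D"
proof -
  obtain H where H: "frame w h c B K D H" using assms by (auto simp: framed_def)
  have mem: "(x, y) \<in> prod.swap ` X \<longleftrightarrow> (y, x) \<in> X" for x y :: int and X by force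
  have "prod.swap ` (rect w h - H - B) = rect h w - prod.swap ` H - prod.swap ` B"
    by (simp add: image_set_diff swap_rect)
  then have "conn (rect h w - prod.swap ` H - prod.swap ` B)"
    using H conn_swap unfolding frame_def by metis
  moreover have "\<forall>p\<in>prod.swap ` H. \<forall>q. adj p q \<longrightarrow> q \<notin> prod.swap ` H \<and> q \<notin> prod.swap ` B"
  proof (intro ballI allI impI)
    fix p q assume "p \<in> prod.swap ` H" "adj p q"
    then have "prod.swap p \<in> H" "adj (prod.swap p) (prod.swap q)" by auto
    then have "prod.swap q \<notin> H \<and> prod.swap q \<notin> B" using H unfolding frame_def by blast
    then show "q \<notin> prod.swap ` H \<and> q \<notin> prod.swap ` B" by auto
  qed
  moreover have "card (prod.swap ` H) = card H" by (simp add: card_image)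
  moreover have "prod.swap ` H \<subseteq> {1..h - 2} \<times> {1..w - 2}" "prod.swap ` B \<subseteq> {0..h - 3} \<times> {0..w - 3}"
    "prod.swap ` K \<subseteq> {0..2} \<times> {0..2}" "prod.swap ` K \<inter> prod.swap ` H = {}" "prod.swap ` B \<inter> prod.swap ` H = {}"
    using H unfolding frame_def by (auto simp: mem)
  ultimately have "frame h w c (prod.swap ` B) (prod.swap ` K) D (prod.swap ` H)"
    using H unfolding frame_def by (auto simp: mem algebra_simps)
  then show ?thesis by (auto simp: framed_def)
qed

text \<open>The new holes are a zigzag in the rows \<open>h\<close> and \<open>h + 1\<close>, one in
  each of the \<open>w - 2\<close> inner columns, and one more hole \<open>(e, h - 1)\<close> below
  it: \<open>w - 1\<close> in all, as three rows require. Since \<open>w\<close> is even, exactly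
  one of the two inner ends of row \<open>h - 1\<close> has the right parity for
  \<open>e\<close>.\<close>

lemma framed_add_rows:
  assumes "framed w h c B K D" "even w"
  shows "framed w (h + 3) c B K D"
proof -
  obtain H where H: "frame w h c B K D H" using assms by (auto simp: framed_def)
  have wh: "4 \<le> w" "4 \<le> h" and Hsub: "H \<subseteq> {1..w - 2} \<times> {1..h - 2}" and Bsub: "B \<subseteq> {0..w - 3} \<times> {0..h - 3}"
    and K: "K \<subseteq> {0..2} \<times> {0..2}" "K \<inter> H = {}" and BH: "B \<inter> H = {}"
    and iso: "\<And>p q. p \<in> H \<Longrightarrow> adj p q \<Longrightarrow> q \<notin> H \<and> q \<notin> B" and cZ: "conn (rect w h - H - B)"
    and top: "\<And>x. 1 \<le> x \<Longrightarrow> x \<le> w - 2 \<Longrightarrow> (x, h - 2) \<in> H \<longleftrightarrow> even (x + (h - 2) + c)"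
    and right: "\<And>y. 1 \<le> y \<Longrightarrow> y \<le> h - 2 \<Longrightarrow> (w - 2, y) \<in> H \<longleftrightarrow> even (w - 2 + y + c)"
    and D: "3 * int (card H) + D = (w - 1) * (h - 1)"
    using H unfolding frame_def by auto
  have Hmem: "1 \<le> x \<and> x \<le> w - 2 \<and> 1 \<le> y \<and> y \<le> h - 2" if "(x, y) \<in> H" for x y using Hsub that by auto
  have Bmem: "0 \<le> x \<and> x \<le> w - 3 \<and> 0 \<le> y \<and> y \<le> h - 3" if "(x, y) \<in> B" for x y using Bsub that by auto
  have finH: "finite H" using Hsub by (rule finite_subset) simp
  define e where "e = (if even (h + c) then 1 else w - 2)"
  define f where "f x = (x, if even (x + h + c) then h else h + 1)" for x :: int
  define N where "N = insert (e, h - 1) (f ` {1..w - 2})"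
  have e_even: "even (e + (h - 1) + c)" using assms(2) by (auto simp: e_def)
  have e_range: "1 \<le> e" "e \<le> w - 2" using wh by (auto simp: e_def)
  have Nmem: "(x, y) \<in> N \<longleftrightarrow> (x = e \<and> y = h - 1) \<or> (1 \<le> x \<and> x \<le> w - 2 \<and> (y = h \<or> y = h + 1) \<and> even (x + y + c))" for x y
    unfolding N_def f_def by (auto simp: image_iff)
  have N_even: "even (x + y + c)" if "(x, y) \<in> N" for x y using that e_even by (auto simp: Nmem)
  have N_range: "1 \<le> x \<and> x \<le> w - 2 \<and> h - 1 \<le> y \<and> y \<le> h + 1" if "(x, y) \<in> N" for x y
    using that e_range by (auto simp: Nmem)
  have "inj_on f {1..w - 2}" by (auto simp: inj_on_def f_def)
  moreover have "(e, h - 1) \<notin> f ` {1..w - 2}" by (auto simp: f_def split: if_splits)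
  ultimately have cardN: "int (card N) = w - 1" and finN: "finite N"
    using wh by (simp_all add: N_def card_image)
  have HN: "H \<inter> N = {}" using Hmem N_range by fastforce
  let ?H = "H \<union> N" and ?h = "h + 3"
  have card': "3 * int (card ?H) + D = (w - 1) * (?h - 1)"
    using D cardN card_Un_disjoint[OF finH finN HN] by (simp add: algebra_simps)
  let ?Z = "rect w h - H - B" and ?Z' = "rect w ?h - ?H - B"
  define r where "r = (0 :: int, h + 2)"
  \<comment> \<open>Everything is linked to the new top left corner. The outer columns and the new
    top row are free; row \<open>h\<close> hangs on row \<open>h - 1\<close>, which is reached from
    the outer columns on both sides of \<open>e\<close>, and row \<open>h + 1\<close> hangs on the
    top row.\<close>
  define R where "R = {q. (q, r) \<in> (steps ?Z')\<^sup>*}"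
  have R_trans: "p \<in> R" if "q \<in> R" "(p, q) \<in> (steps ?Z')\<^sup>*" for p q
    using rtrancl_trans[OF that(2)] that(1) unfolding R_def by simp
  have R_step: "p \<in> R" if "q \<in> R" "p \<in> ?Z'" "q \<in> ?Z'" "adj p q" for p q
    using R_trans[OF that(1) stepI[OF that(2-4)]] .
  have R_hor: "(x, y) \<in> R" if "(x', y) \<in> R" "\<And>x. a \<le> x \<Longrightarrow> x \<le> b \<Longrightarrow> (x, y) \<in> ?Z'" "a \<le> x" "x \<le> b" "a \<le> x'" "x' \<le> b" for x y x' a b
    using R_trans[OF that(1) steps_horizontal[OF that(2-6)]] .
  have R_ver: "(x, y) \<in> R" if "(x, y') \<in> R" "\<And>y. a \<le> y \<Longrightarrow> y \<le> b \<Longrightarrow> (x, y) \<in> ?Z'" "a \<le> y" "y \<le> b" "a \<le> y'" "y' \<le> b" for x y y' a b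
    using R_trans[OF that(1) steps_vertical[OF that(2-6)]] .
  have Z'mem: "(x, y) \<in> ?Z' \<longleftrightarrow> 0 \<le> x \<and> x < w \<and> 0 \<le> y \<and> y < h + 3 \<and> (x, y) \<notin> H \<and> (x, y) \<notin> N \<and> (x, y) \<notin> B" for x y
    by auto
  have left_Z': "(0, y) \<in> ?Z'" "(w - 1, y) \<in> ?Z'" if "h - 2 \<le> y" "y \<le> h + 2" for y
    unfolding Z'mem using that wh Hmem N_range Bmem by fastforce+
  have top_Z': "(x, h + 2) \<in> ?Z'" if "0 \<le> x" "x \<le> w - 1" for x
    unfolding Z'mem using that wh Hmem[of x "h + 2"] N_range[of x "h + 2"] Bmem[of x "h + 2"] by auto
  have row_Z': "(x, h - 1) \<in> ?Z'" if "0 \<le> x" "x \<le> w - 1" "x \<noteq> e" for x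
    unfolding Z'mem using that wh Hmem[of x "h - 1"] Nmem[of x "h - 1"] Bmem[of x "h - 1"] by auto
  have r_R: "(0, h + 2) \<in> R" by (simp add: R_def r_def)
  have top_R: "(x, h + 2) \<in> R" if x: "0 \<le> x" "x \<le> w - 1" for x
    by (rule R_hor[OF r_R top_Z' x]) (use wh in simp_all)
  have left_R: "(0, y) \<in> R" if y: "h - 2 \<le> y" "y \<le> h + 2" for y
    by (rule R_ver[OF r_R left_Z'(1) y]) simp_all
  have right_R: "(w - 1, y) \<in> R" if y: "h - 2 \<le> y" "y \<le> h + 2" for y
    by (rule R_ver[OF top_R left_Z'(2) y]) (use wh in simp_all)
  have row_R: "(x, h - 1) \<in> R" if x: "0 \<le> x" "x \<le> w - 1" "x \<noteq> e" for x
  proof (cases "x < e")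
    case True
    show ?thesis
      by (rule R_hor[of 0 "h - 1" 0 "e - 1"]; (rule left_R row_Z')?) (use True x e_range in simp_all)
  next
    case False
    show ?thesis
      by (rule R_hor[of "w - 1" "h - 1" "e + 1" "w - 1"]; (rule right_R row_Z')?) (use False x e_range in simp_all)
  qed
  have e_nbr: "(e, y) \<in> R" if y: "(e, y) \<in> ?Z'" "h - 2 \<le> y" "y \<le> h + 2" for y
  proof (cases "even (h + c)")
    case True
    then have "e = 1" by (simp add: e_def)
    then show ?thesis using R_step[OF left_R[OF y(2,3)] y(1)] left_Z'(1)[OF y(2,3)] by simp
  next
    case False
    then have "e = w - 2" by (simp add: e_def)
    then show ?thesis using R_step[OF right_R[OF y(2,3)] y(1)] left_Z'(2)[OF y(2,3)] by simp
  qed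
  have v: "(e, h - 1) \<in> ?Z" using e_range wh Hmem[of e "h - 1"] Bmem[of e "h - 1"] by auto
  have below: "(e, h - 2) \<notin> H" using top[OF e_range] e_even by auto
  \<comment> \<open>The only old free cell that is lost is \<open>(e, h - 1)\<close>. All its old
    neighbours reach \<open>R\<close> without it, so old paths through it can be rerouted.\<close>
  have old: "?Z \<subseteq> insert (e, h - 1) R"
  proof (rule conn_subset[OF cZ v])
    fix a b assume ab: "a \<in> insert (e, h - 1) R" "a \<in> ?Z" "b \<in> ?Z" "adj a b"
    obtain x y where b: "b = (x, y)" by (cases b)
    show "b \<in> insert (e, h - 1) R"
    proof (cases "a = (e, h - 1)")
      case True
      then have "b = (e + 1, h - 1) \<or> b = (e - 1, h - 1) \<or> b = (e, h) \<or> b = (e, h - 2)"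
        using adj_neighbour_cases[of e "h - 1" b] ab(4) by simp
      moreover have "b \<noteq> (e, h)" using ab(3) by auto
      moreover have "(e, h - 2) \<in> ?Z'" using below e_range wh Bmem[of e "h - 2"] Nmem[of e "h - 2"] by auto
      then have "(e, h - 2) \<in> R" using e_nbr by simp
      moreover have "(e + 1, h - 1) \<in> R" "(e - 1, h - 1) \<in> R" using e_range by (auto intro: row_R)
      ultimately show ?thesis by blast
    next
      case False
      have in_Z': "p \<in> ?Z'" if "p \<in> ?Z" "p \<noteq> (e, h - 1)" for p
      proof (cases p)
        case (Pair u v)
        then show ?thesis using that Nmem[of u v] by auto
      qed
      show ?thesis
        using R_step[OF _ in_Z'[OF ab(3)] in_Z'[OF ab(2) False] adj_sym[OF ab(4)]] ab(1) False by blast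
    qed
  qed simp
  have conn': "conn ?Z'"
  proof (rule connI)
    fix q assume q: "q \<in> ?Z'"
    obtain x y where xy: "q = (x, y)" by (cases q)
    have m: "0 \<le> x" "x < w" "0 \<le> y" "y < h + 3" "(x, y) \<notin> H" "(x, y) \<notin> N" "(x, y) \<notin> B"
      using q unfolding xy Z'mem by auto
    consider "y \<le> h - 1" | "y \<ge> h" "x = 0 \<or> x = w - 1 \<or> x = e \<or> y = h + 2" |
      "y = h" "1 \<le> x" "x \<le> w - 2" "x \<noteq> e" | "y = h + 1" "1 \<le> x" "x \<le> w - 2" using m by linarith
    then have "(x, y) \<in> R"
    proof cases
      case 1
      then have "(x, y) \<in> ?Z" "(x, y) \<noteq> (e, h - 1)" using m by (auto simp: Nmem)
      then show ?thesis using old by blast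
    next
      case 2
      then show ?thesis using left_R right_R top_R e_nbr q m unfolding xy by auto
    next
      case 3
      then show ?thesis using R_step[OF row_R[of x] q[unfolded xy] row_Z'[of x]] by simp
    next
      case 4
      then show ?thesis using R_step[OF top_R[of x] q[unfolded xy] top_Z'[of x]] by simp
    qed
    then show "(q, r) \<in> (steps ?Z')\<^sup>*" by (simp add: R_def xy)
  qed
  have HN_adj: "\<not> adj p q" if "p \<in> H" "q \<in> N" for p q
  proof
    assume pq: "adj p q"
    obtain x y x' y' where xy: "p = (x, y)" "q = (x', y')" by (cases p, cases q)
    have "x = x' \<and> y = h - 2 \<and> y' = h - 1"
      using pq Hmem[of x y] N_range[of x' y'] that unfolding xy by auto
    then have "p = (e, h - 2)" using that(2) unfolding xy Nmem by auto
    then show False using below that(1) by simp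
  qed
  have iso': "q \<notin> ?H \<and> q \<notin> B" if p: "p \<in> ?H" and pq: "adj p q" for p q
  proof (cases "p \<in> H")
    case True
    then show ?thesis using iso[OF True pq] HN_adj[OF True] pq by blast
  next
    case False
    then have pN: "p \<in> N" using p by simp
    obtain x y x' y' where xy: "p = (x, y)" "q = (x', y')" by (cases p, cases q)
    have "odd (x' + y' + c)" using N_even[of x y] pN pq unfolding xy
      by (auto simp: abs_if split: if_splits) presburger+
    then have "q \<notin> N" using N_even unfolding xy by blast
    moreover have "q \<notin> H" using HN_adj pN adj_sym[OF pq] by blast
    moreover have "q \<notin> B" using Bmem[of x' y'] N_range[of x y] pN pq unfolding xy by auto
    ultimately show ?thesis by simp
  qed
  have top': "(x, ?h - 2) \<in> ?H \<longleftrightarrow> even (x + (?h - 2) + c)" if "1 \<le> x" "x \<le> w - 2" for x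
  proof -
    have h1: "?h - 2 = h + 1" by simp
    show ?thesis unfolding h1 using that Hmem[of x "h + 1"] Nmem[of x "h + 1"] by auto
  qed
  have right': "(w - 2, y) \<in> ?H \<longleftrightarrow> even (w - 2 + y + c)" if y: "1 \<le> y" "y \<le> ?h - 2" for y
  proof -
    consider "y \<le> h - 2" | "y = h - 1" | "y = h \<or> y = h + 1" using y by linarith
    then show ?thesis
    proof cases
      case 1
      then show ?thesis using right[of y] y N_range[of "w - 2" y] by auto
    next
      case 2
      then show ?thesis using Hmem[of "w - 2" "h - 1"] wh assms(2) by (auto simp: Nmem e_def)
    next
      case 3
      then show ?thesis using Hmem[of "w - 2" y] wh by (auto simp: Nmem)
    qed
  qed
  have KN: "K \<inter> N = {}" using K(1) N_range wh by fastforce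
  have BN: "B \<inter> N = {}" using Bmem N_range by fastforce
  have "frame w ?h c B K D ?H"
    unfolding frame_def
  proof (intro conjI ballI allI impI)
    show "?H \<subseteq> {1..w - 2} \<times> {1..?h - 2}" using Hmem N_range wh by fastforce
    show "B \<subseteq> {0..w - 3} \<times> {0..?h - 3}" using Bmem by fastforce
    show "K \<inter> ?H = {}" "B \<inter> ?H = {}" using K(2) KN BN BH by blast+
  qed (use wh K(1) iso' conn' top' right' card' in \<open>auto simp del: Un_iff\<close>)
  then show ?thesis by (auto simp: framed_def)
qed

lemma framed_grow_rows:
  assumes "framed w h c B K D" "even w"
  shows "framed w (h + 3 * int j) c B K D"
proof (induction j)
  case (Suc j)
  then show ?case using framed_add_rows[OF Suc assms(2)] by (simp add: algebra_simps)
qed (use assms in simp)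

text \<open>Columns are added first and six at a time, so that the width is still even when the rows
  follow; the final height may be odd.\<close>

lemma framed_grow:
  assumes "framed w h c B K D" "even w" "even h"
  shows "framed (w + 6 * int i) (h + 3 * int j) c B K D"
proof -
  have "framed h (w + 3 * int (2 * i)) c (prod.swap ` B) (prod.swap ` K) D"
    using framed_swap[OF assms(1)] assms(3) by (rule framed_grow_rows)
  from framed_swap[OF this] have "framed (w + 6 * int i) h c B K D" by (simp add: image_image)
  then show ?thesis using assms(2) by (intro framed_grow_rows) auto
qed

section \<open>Six small frames, checked by evaluation\<close>

text \<open>An executable certificate of connectivity: the list, read from its end, is an order in
  which the set grows cell by cell.\<close>

fun linked :: "cell list \<Rightarrow> bool" where
  "linked (p # q # ps) \<longleftrightarrow> (\<exists>r\<in>set (q # ps). adj p r) \<and> linked (q # ps)"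
| "linked _ \<longleftrightarrow> True"

lemma conn_linked: "linked ps \<Longrightarrow> conn (set ps)"
proof (induction ps rule: linked.induct)
  case (1 p q ps)
  then have c: "conn (set (q # ps))" by simp
  from 1(2) have "\<exists>r\<in>set (q # ps). adj p r" by (simp only: linked.simps)
  then obtain s where s: "s \<in> set (q # ps)" "adj p s" by blast
  show ?case
  proof (rule connI[of _ s])
    fix x assume "x \<in> set (p # q # ps)"
    then consider "x = p" | "x \<in> set (q # ps)" by auto
    then show "(x, s) \<in> (steps (set (p # q # ps)))\<^sup>*"
    proof cases
      case 1
      then show ?thesis using s by (intro stepI) auto
    next
      case 2
      then have "(x, s) \<in> (steps (set (q # ps)))\<^sup>*" using c s by (auto simp: conn_def)
      then show ?thesis by (rule steps_rtrancl_mono) auto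
    qed
  qed
qed (auto simp: conn_def)

lemma framed_code:
  assumes "list_all (\<lambda>(x, y). 1 \<le> x \<and> x \<le> w - 2 \<and> 1 \<le> y \<and> y \<le> h - 2 \<and>
       list_all (\<lambda>q. q \<in> set Z) [(x + 1, y), (x - 1, y), (x, y + 1), (x, y - 1)]) H"
    and "4 \<le> w \<and> 4 \<le> h \<and> 3 * int (length H) + D = (w - 1) * (h - 1) \<and> distinct H \<and> linked Z"
    and "list_all (\<lambda>(x, y). 0 \<le> x \<and> x \<le> w - 3 \<and> 0 \<le> y \<and> y \<le> h - 3 \<and> (x, y) \<notin> set H) B"
    and "list_all (\<lambda>(x, y). 0 \<le> x \<and> x \<le> 2 \<and> 0 \<le> y \<and> y \<le> 2 \<and> (x, y) \<notin> set H) K"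
    and "list_all (\<lambda>x. list_all (\<lambda>y. ((x, y) \<in> set Z) = ((x, y) \<notin> set H \<and> (x, y) \<notin> set B)) [0..h - 1]) [0..w - 1]"
    and "list_all (\<lambda>(x, y). 0 \<le> x \<and> x \<le> w - 1 \<and> 0 \<le> y \<and> y \<le> h - 1) Z"
    and "list_all (\<lambda>x. (x, h - 2) \<in> set H \<longleftrightarrow> even (x + (h - 2) + c)) [1..w - 2]"
    and "list_all (\<lambda>y. (w - 2, y) \<in> set H \<longleftrightarrow> even (w - 2 + y + c)) [1..h - 2]"
  shows "framed w h c (set B) (set K) D"
proof -
  have Z: "rect w h - set H - set B = set Z"
    using assms(5,6) by (fastforce simp: list_all_iff)
  have nbr: "q \<in> set Z" if "p \<in> set H" "adj p q" for p q
  proof -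
    obtain x y where p: "p = (x, y)" by (cases p)
    show ?thesis using assms(1) that adj_neighbour_cases[of x y q] unfolding p by (fastforce simp: list_all_iff)
  qed
  have "frame w h c (set B) (set K) D (set H)"
    unfolding frame_def
  proof (intro conjI ballI allI impI)
    show "q \<notin> set H" "q \<notin> set B" if "p \<in> set H" "adj p q" for p q using nbr[OF that] Z by blast+
    show "conn (rect w h - set H - set B)" unfolding Z using assms(2) conn_linked by blast
    show "3 * int (card (set H)) + D = (w - 1) * (h - 1)" using assms(2) by (simp add: distinct_card)
  qed (use assms in \<open>auto simp: list_all_iff\<close>)
  then show ?thesis by (auto simp: framed_def)
qed


text \<open>The empty origin and two corners to be trimmed later make up the deficit 3.\<close>

lemma framed_4_4: "framed 4 4 0 (set [(0, 0)]) (set []) 3"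
  by (rule framed_code[where H =
    "[(1, 1), (2, 2)]" and Z =
    "[(0, 1), (1, 2), (0, 2), (0, 3), (1, 3), (2, 3), (3, 3), (3, 2), (2, 1), (3, 1), (3, 0), (2, 0), (1, 0)]"]; code_simp)

lemma framed_6_4: "framed 6 4 0 (set [(0, 0)]) (set []) 3"
  by (rule framed_code[where H =
    "[(1, 1), (3, 1), (2, 2), (4, 2)]" and Z =
    "[(2, 1), (3, 2), (0, 1), (1, 2), (0, 2), (0, 3), (1, 3), (2, 3), (3, 3), (4, 3), (5, 3), (5, 2), (4, 1),
    (5, 1), (5, 0), (4, 0), (3, 0), (2, 0), (1, 0)]"]; code_simp)

lemma framed_8_4: "framed 8 4 0 (set [(0, 0)]) (set []) 3"
  by (rule framed_code[where H =
    "[(1, 1), (3, 1), (5, 1), (2, 2), (4, 2), (6, 2)]" and Z =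
    "[(2, 1), (4, 1), (5, 2), (3, 2), (0, 1), (1, 2), (0, 2), (0, 3), (1, 3), (2, 3), (3, 3), (4, 3), (5, 3),
    (6, 3), (7, 3), (7, 2), (6, 1), (7, 1), (7, 0), (6, 0), (5, 0), (4, 0), (3, 0), (2, 0), (1, 0)]"]; code_simp)

text \<open>\<open>K\<close> keeps a way free around the hole \<open>(1, 1)\<close>, which will
  allow all three remaining corners to be trimmed: together with the origin, four empty
  cells.\<close>

lemma framed_6_6: "framed 6 6 0 (set [(0, 0)]) (set [(1, 2), (2, 1), (2, 2)]) 4"
  by (rule framed_code[where H =
    "[(1, 1), (3, 1), (4, 2), (1, 3), (3, 3), (2, 4), (4, 4)]" and Z =
    "[(3, 4), (0, 1), (2, 1), (2, 3), (3, 2), (2, 2), (1, 2), (0, 2), (0, 3), (1, 4), (0, 4), (0, 5), (1, 5),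
    (2, 5), (3, 5), (4, 5), (5, 5), (5, 4), (4, 3), (5, 3), (5, 2), (4, 1), (5, 1), (5, 0), (4, 0), (3, 0),
    (2, 0), (1, 0)]"]; code_simp)

lemma framed_8_8: "framed 8 8 0 (set [(0, 0)]) (set [(1, 2), (2, 1), (2, 2)]) 4"
  by (rule framed_code[where H =
    "[(1, 1), (3, 1), (5, 1), (4, 2), (6, 2), (1, 3), (3, 3), (2, 4), (4, 4), (6, 4), (1, 5), (5, 5), (2, 6),
    (4, 6), (6, 6)]" and Z =
    "[(4, 1), (5, 6), (3, 4), (2, 5), (4, 5), (3, 5), (3, 6), (0, 1), (2, 1), (2, 3), (3, 2), (2, 2), (1, 2),
    (0, 2), (0, 3), (1, 4), (0, 4), (0, 5), (1, 6), (0, 6), (0, 7), (1, 7), (2, 7), (3, 7), (4, 7), (5, 7),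
    (6, 7), (7, 7), (7, 6), (6, 5), (7, 5), (7, 4), (5, 2), (5, 4), (4, 3), (5, 3), (6, 3), (7, 3), (7, 2),
    (6, 1), (7, 1), (7, 0), (6, 0), (5, 0), (4, 0), (3, 0), (2, 0), (1, 0)]"]; code_simp)

text \<open>For odd \<open>c\<close> only one corner is trimmed later, so the four cells of
  \<open>B\<close> supply the rest of the deficit 5.\<close>

lemma framed_8_6: "framed 8 6 1 (set [(0, 0), (1, 0), (2, 0), (3, 0)]) (set []) 5"
  by (rule framed_code[where H =
    "[(4, 1), (6, 1), (1, 2), (3, 2), (5, 2), (2, 3), (6, 3), (1, 4), (3, 4), (5, 4)]" and Z =
    "[(5, 1), (4, 2), (3, 3), (5, 3), (4, 3), (4, 4), (2, 4), (2, 2), (3, 1), (2, 1), (1, 1), (0, 1), (0, 2),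
    (1, 3), (0, 3), (0, 4), (0, 5), (1, 5), (2, 5), (3, 5), (4, 5), (5, 5), (7, 5), (6, 5), (6, 4), (7, 4),
    (7, 3), (6, 2), (7, 2), (7, 1), (7, 0), (6, 0), (5, 0), (4, 0)]"]; code_simp)


section \<open>Packings obtained by trimming the corners of frames\<close>

text \<open>\<open>Z\<close> is the polyomino and \<open>H\<close> its one-cell holes. The same
  \<open>C\<close> counts the other empty cells and is the deficit, which is the condition for
  optimality.\<close>

definition packing :: "int \<Rightarrow> int \<Rightarrow> int \<Rightarrow> cell set \<Rightarrow> cell set \<Rightarrow> bool" where
  "packing w h C Z H \<longleftrightarrow> Z \<subseteq> rect w h \<and> H \<subseteq> rect w h \<and> Z \<inter> H = {} \<and> conn Z \<and>
     (\<forall>p\<in>H. \<forall>q. adj p q \<longrightarrow> q \<in> Z) \<and> int (card (rect w h - Z - H)) = C \<and>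
     3 * int (card H) + C = (w - 1) * (h - 1)"

definition packable :: "int \<Rightarrow> int \<Rightarrow> int \<Rightarrow> bool" where
  "packable w h C \<longleftrightarrow> (\<exists>Z H. packing w h C Z H)"

text \<open>The extra condition serves doubling: of two adjacent cells at least one is a tile, so a
  new cell inserted between their doubles always hangs on a tile.\<close>

definition scattered_packable :: "int \<Rightarrow> int \<Rightarrow> int \<Rightarrow> bool" where
  "scattered_packable w h C \<longleftrightarrow>
     (\<exists>Z H. packing w h C Z H \<and> (\<forall>p\<in>rect w h - Z. \<forall>q\<in>rect w h - Z. \<not> adj p q))"

lemma scattered_imp_packable: "scattered_packable w h C \<Longrightarrow> packable w h C"
  by (auto simp: packable_def scattered_packable_def)

lemma packable_swap:
  assumes "packable w h C"
  shows "packable h w C"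
proof -
  obtain Z H where P: "packing w h C Z H" using assms by (auto simp: packable_def)
  have mem: "p \<in> prod.swap ` X \<longleftrightarrow> prod.swap p \<in> X" for p :: cell and X by force
  have "rect h w - prod.swap ` Z - prod.swap ` H = prod.swap ` (rect w h - Z - H)"
    by (simp add: image_set_diff swap_rect)
  then have 1: "card (rect h w - prod.swap ` Z - prod.swap ` H) = card (rect w h - Z - H)"
    by (simp add: card_image)
  have 2: "card (prod.swap ` H) = card H" by (simp add: card_image)
  have 3: "q \<in> prod.swap ` Z" if "p \<in> prod.swap ` H" "adj p q" for p q
  proof -
    have "prod.swap p \<in> H" "adj (prod.swap p) (prod.swap q)" using that by (simp_all add: mem)
    then show ?thesis using P unfolding packing_def mem by blast
  qed
  have 4: "prod.swap ` Z \<inter> prod.swap ` H = {}" using P unfolding packing_def by (auto simp: mem)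
  have 5: "prod.swap ` Z \<subseteq> rect h w" "prod.swap ` H \<subseteq> rect h w"
    using P image_mono[of Z "rect w h" prod.swap] image_mono[of H "rect w h" prod.swap]
    unfolding packing_def swap_rect by simp_all
  have "packing h w C (prod.swap ` Z) (prod.swap ` H)"
    using P 1 2 3 4 5 conn_swap unfolding packing_def by (auto simp: algebra_simps)
  then show ?thesis unfolding packable_def by blast
qed

lemma conn_remove_corner:
  assumes "conn Z" "k \<in> Z" "d \<in> Z" "k \<noteq> d" "\<And>q. q \<in> Z \<Longrightarrow> adj k q \<Longrightarrow> adj q d"
  shows "conn (Z - {k})"
  using assms by (intro conn_remove[where r = d] stepI) auto

lemma frame_trim:
  assumes frm: "frame w h c B K D H"
    and X: "X \<subseteq> {(0, h - 1), (w - 1, h - 1), (w - 1, 0)}"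
    and con: "conn (rect w h - H - B - X)" and card: "int (card B) + int (card X) = D"
  shows "packing w h D (rect w h - H - B - X) H"
    and "B = {(0, 0)} \<Longrightarrow> scattered_packable w h D"
proof -
  let ?Z = "rect w h - H - B - X"
  have wh: "4 \<le> w" "4 \<le> h" and Hsub: "H \<subseteq> {1..w - 2} \<times> {1..h - 2}" and Bsub: "B \<subseteq> {0..w - 3} \<times> {0..h - 3}"
    and BH: "B \<inter> H = {}" and iso: "\<And>p q. p \<in> H \<Longrightarrow> adj p q \<Longrightarrow> q \<notin> H \<and> q \<notin> B"
    and D: "3 * int (card H) + D = (w - 1) * (h - 1)"
    using frm unfolding frame_def by auto
  have nbr: "q \<in> ?Z" if p: "p \<in> H" "adj p q" for p q
  proof -
    obtain x y u v where xy: "p = (x, y)" "q = (u, v)" by (cases p, cases q)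
    have b: "1 \<le> x" "x \<le> w - 2" "1 \<le> y" "y \<le> h - 2" using Hsub p(1) unfolding xy by auto
    have "(u, v) \<in> rect w h" using b p(2) unfolding xy by auto
    moreover have "(u, v) \<notin> X" using b p(2) X wh unfolding xy by auto
    ultimately show ?thesis using iso[OF p] unfolding xy by blast
  qed
  have XB: "B \<inter> X = {}" using Bsub X wh by fastforce
  have XH: "H \<inter> X = {}" using Hsub X wh by fastforce
  have "finite X" "finite B" using X Bsub by (auto intro: finite_subset)
  then have "card (B \<union> X) = card B + card X" using XB by (intro card_Un_disjoint)
  moreover have "rect w h - ?Z - H = B \<union> X"
  proof -
    have "B \<subseteq> rect w h" "X \<subseteq> rect w h" using Bsub X wh by fastforce+
    then show ?thesis using BH XH by blast
  qed
  ultimately have cardC: "int (card (rect w h - ?Z - H)) = D" using card by simp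
  have "H \<subseteq> rect w h" using Hsub by fastforce
  then show P: "packing w h D ?Z H"
    unfolding packing_def using con nbr cardC D by blast
  assume B: "B = {(0, 0)}"
  have "\<not> adj p q" if p: "p \<in> rect w h - ?Z" and q: "q \<in> rect w h - ?Z" for p q
  proof
    assume pq: "adj p q"
    have "p \<notin> H" using nbr[OF _ pq] q by blast
    moreover have "q \<notin> H" using nbr[OF _ adj_sym[OF pq]] p by blast
    ultimately have "p \<in> {(0, 0), (0, h - 1), (w - 1, h - 1), (w - 1, 0)}" "q \<in> {(0, 0), (0, h - 1), (w - 1, h - 1), (w - 1, 0)}"
      using p q X unfolding B by blast+
    then show False using pq wh by (auto simp: abs_if split: if_splits)
  qed
  then show "scattered_packable w h D" using P unfolding scattered_packable_def by blast
qed

lemma conn_trim_top_left: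
  assumes "conn Z" "Z \<subseteq> rect w h" "2 \<le> w" "2 \<le> h" "(0, h - 1) \<in> Z" "(1, h - 2) \<in> Z"
  shows "conn (Z - {(0, h - 1)})"
proof (rule conn_remove_corner[OF assms(1,5,6)])
  fix q assume q: "q \<in> Z" "adj (0, h - 1) q"
  have "q \<in> rect w h" using q assms(2) by blast
  then show "adj q (1, h - 2)" using adj_neighbour_cases[OF q(2)] by (elim disjE) simp_all
qed simp

lemma conn_trim_top_right:
  assumes "conn Z" "Z \<subseteq> rect w h" "2 \<le> w" "2 \<le> h" "(w - 1, h - 1) \<in> Z" "(w - 2, h - 2) \<in> Z"
  shows "conn (Z - {(w - 1, h - 1)})"
proof (rule conn_remove_corner[OF assms(1,5,6)])
  fix q assume q: "q \<in> Z" "adj (w - 1, h - 1) q"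
  have "q \<in> rect w h" using q assms(2) by blast
  then show "adj q (w - 2, h - 2)" using adj_neighbour_cases[OF q(2)] by (elim disjE) simp_all
qed simp

lemma conn_trim_bottom_right:
  assumes "conn Z" "Z \<subseteq> rect w h" "2 \<le> w" "2 \<le> h" "(w - 1, 0) \<in> Z" "(w - 2, 1) \<in> Z"
  shows "conn (Z - {(w - 1, 0)})"
proof (rule conn_remove_corner[OF assms(1,5,6)])
  fix q assume q: "q \<in> Z" "adj (w - 1, 0) q"
  have "q \<in> rect w h" using q assms(2) by blast
  then show "adj q (w - 2, 1)" using adj_neighbour_cases[OF q(2)] by (elim disjE) simp_all
qed simp

lemma frame_mem:
  assumes "frame w h c B K D H"
  shows "(x, y) \<in> H \<Longrightarrow> 1 \<le> x \<and> x \<le> w - 2 \<and> 1 \<le> y \<and> y \<le> h - 2"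
    and "(x, y) \<in> B \<Longrightarrow> 0 \<le> x \<and> x \<le> w - 3 \<and> 0 \<le> y \<and> y \<le> h - 3"
  using assms unfolding frame_def by auto

text \<open>A corner can go if its diagonal neighbour is free, as this cell joins the two neighbours
  of the corner. By the parity rule and even \<open>w\<close>, this holds for exactly one top
  corner, and for the bottom right corner if and only if \<open>c\<close> is even; hence the
  \<open>2\<close> and the \<open>1\<close> in the assumption.\<close>

lemma framed_packable:
  assumes "framed w h c B K D" "even w" "int (card B) + (if even c then 2 else 1) = D"
  shows "packable w h D" and "B = {(0, 0)} \<Longrightarrow> scattered_packable w h D"
proof -
  obtain H where frm: "frame w h c B K D H" using assms by (auto simp: framed_def)
  have wh: "4 \<le> w" "4 \<le> h" and con: "conn (rect w h - H - B)"
    and top: "\<And>x. 1 \<le> x \<Longrightarrow> x \<le> w - 2 \<Longrightarrow> (x, h - 2) \<in> H \<longleftrightarrow> even (x + (h - 2) + c)"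
    and right: "\<And>y. 1 \<le> y \<Longrightarrow> y \<le> h - 2 \<Longrightarrow> (w - 2, y) \<in> H \<longleftrightarrow> even (w - 2 + y + c)"
    using frm unfolding frame_def by auto
  have mem: "(x, y) \<in> rect w h - H - B" if "0 \<le> x" "x < w" "0 \<le> y" "y < h" "(x, y) \<notin> H" "x > w - 3 \<or> y > h - 3" for x y
    using that frame_mem(2)[OF frm, of x y] by auto
  define T where "T = (if even (h + c) then (0, h - 1) else (w - 1, h - 1))"
  have T: "conn (rect w h - H - B - {T})"
  proof (cases "even (h + c)")
    case True
    then have "conn (rect w h - H - B - {(0, h - 1)})"
      using wh top[of 1] frame_mem(1)[OF frm, of 0 "h - 1"] by (intro conn_trim_top_left[OF con] mem) auto
    then show ?thesis using True by (simp add: T_def)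
  next
    case False
    then have "conn (rect w h - H - B - {(w - 1, h - 1)})"
      using wh assms(2) top[of "w - 2"] frame_mem(1)[OF frm, of "w - 1" "h - 1"]
      by (intro conn_trim_top_right[OF con] mem) auto
    then show ?thesis using False by (simp add: T_def)
  qed
  define X where "X = (if even c then {T, (w - 1, 0)} else {T})"
  have TB: "T \<noteq> (w - 1, 0)" "T \<noteq> (w - 2, 1)" using wh by (auto simp: T_def)
  have "conn (rect w h - H - B - X)"
  proof (cases "even c")
    case True
    have "conn (rect w h - H - B - {T} - {(w - 1, 0)})"
    proof (rule conn_trim_bottom_right[OF T])
      have "(w - 1, 0) \<in> rect w h - H - B" "(w - 2, 1) \<in> rect w h - H - B"
        by (rule mem; use wh True assms(2) right[of 1] frame_mem(1)[OF frm, of "w - 1" 0] in force)+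
      then show "(w - 1, 0) \<in> rect w h - H - B - {T}" "(w - 2, 1) \<in> rect w h - H - B - {T}"
        using TB by blast+
    qed (use wh in auto)
    moreover have "rect w h - H - B - {T} - {(w - 1, 0)} = rect w h - H - B - {T, (w - 1, 0)}" by blast
    ultimately show ?thesis using True by (simp only: X_def if_True)
  next
    case False
    then show ?thesis using T by (simp add: X_def)
  qed
  moreover have "X \<subseteq> {(0, h - 1), (w - 1, h - 1), (w - 1, 0)}" by (auto simp: X_def T_def)
  moreover have "int (card B) + int (card X) = D" using assms(3) TB by (auto simp: X_def)
  ultimately show "packable w h D" "B = {(0, 0)} \<Longrightarrow> scattered_packable w h D"
    using frame_trim[OF frm] unfolding packable_def by blast+
qed

text \<open>With even width and height the top right corner is next to a hole. It can be removed
  as well because the cells of \<open>K\<close> join the left column to the bottom row.\<close>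

lemma framed_packable_four:
  assumes "framed w h 0 {(0, 0)} {(1, 2), (2, 1), (2, 2)} 4" "even w" "even h"
  shows "scattered_packable w h 4"
proof -
  let ?B = "{(0, 0)}" and ?K = "{(1, 2), (2, 1), (2, 2)} :: cell set"
  obtain H where frm: "frame w h 0 ?B ?K 4 H" using assms by (auto simp: framed_def)
  have wh: "4 \<le> w" "4 \<le> h" and con: "conn (rect w h - H - ?B)" and K: "?K \<inter> H = {}"
    and top: "\<And>x. 1 \<le> x \<Longrightarrow> x \<le> w - 2 \<Longrightarrow> (x, h - 2) \<in> H \<longleftrightarrow> even (x + (h - 2) + 0)"
    and right: "\<And>y. 1 \<le> y \<Longrightarrow> y \<le> h - 2 \<Longrightarrow> (w - 2, y) \<in> H \<longleftrightarrow> even (w - 2 + y + 0)"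
    using frm unfolding frame_def by auto
  have Hmem: "1 \<le> x \<and> x \<le> w - 2 \<and> 1 \<le> y \<and> y \<le> h - 2" if "(x, y) \<in> H" for x y
    using frame_mem(1)[OF frm that] .
  define Z where "Z = rect w h - H - ?B"
  define TR where "TR = (w - 1, h - 1)"
  have Zmem: "(x, y) \<in> Z - {TR} \<longleftrightarrow> 0 \<le> x \<and> x < w \<and> 0 \<le> y \<and> y < h \<and> (x, y) \<notin> H \<and> (x, y) \<noteq> (0, 0) \<and> (x, y) \<noteq> (w - 1, h - 1)" for x y
    by (auto simp: Z_def TR_def)
  have border: "(x, y) \<in> Z - {TR}" if "0 \<le> x" "x < w" "0 \<le> y" "y < h" "x = 0 \<or> x = w - 1 \<or> y = 0 \<or> y = h - 1"
    "(x, y) \<noteq> (0, 0)" "(x, y) \<noteq> (w - 1, h - 1)" for x y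
    using that Hmem[of x y] unfolding Zmem by auto
  have K': "(1, 2) \<in> Z - {TR}" "(2, 1) \<in> Z - {TR}" "(2, 2) \<in> Z - {TR}"
    using K wh unfolding Zmem by auto
  let ?S = "(steps (Z - {TR}))\<^sup>*"
  have s1: "((w - 2, h - 1), (0, h - 1)) \<in> ?S"
    by (rule steps_horizontal[of 0 "w - 2"]; (rule border)?) (use wh in auto)
  have s2: "((0, h - 1), (0, 2)) \<in> ?S"
    by (rule steps_vertical[of 2 "h - 1"]; (rule border)?) (use wh in auto)
  have s3: "((0, 2), (1, 2)) \<in> ?S" "((1, 2), (2, 2)) \<in> ?S" "((2, 2), (2, 1)) \<in> ?S" "((2, 1), (2, 0)) \<in> ?S"
    using K' border[of 0 2] border[of 2 0] wh by (auto intro!: stepI)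
  have s4: "((2, 0), (w - 1, 0)) \<in> ?S"
    by (rule steps_horizontal[of 2 "w - 1"]; (rule border)?) (use wh in auto)
  have s5: "((w - 1, 0), (w - 1, h - 2)) \<in> ?S"
    by (rule steps_vertical[of 0 "h - 2"]; (rule border)?) (use wh in auto)
  have path: "((w - 2, h - 1), (w - 1, h - 2)) \<in> ?S"
    using s1 s2 s3 s4 s5 by (meson rtrancl_trans)
  have "conn (Z - {TR})"
  proof (rule conn_remove)
    show "conn Z" using con by (simp add: Z_def)
    show "TR \<in> Z" using wh Hmem[of "w - 1" "h - 1"] by (auto simp: Z_def TR_def)
    fix q assume q: "q \<in> Z" "adj TR q"
    have "q \<in> rect w h" using q by (auto simp: Z_def)
    then have "q = (w - 2, h - 1) \<or> q = (w - 1, h - 2)"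
      using adj_neighbour_cases[OF q(2)[unfolded TR_def]] by (elim disjE) simp_all
    then show "(q, (w - 1, h - 2)) \<in> ?S" using path by auto
  qed
  then have "conn (Z - {TR} - {(0, h - 1)})"
    by (rule conn_trim_top_left[of _ w])
      (use wh top[of 1] assms(3) border[of 0 "h - 1"] in \<open>auto simp: Z_def TR_def\<close>)
  then have "conn (Z - {TR} - {(0, h - 1)} - {(w - 1, 0)})"
    by (rule conn_trim_bottom_right[of _ w h])
      (use wh right[of 1] assms(2) border[of "w - 1" 0] in \<open>auto simp: Z_def TR_def\<close>)
  moreover have "Z - {TR} - {(0, h - 1)} - {(w - 1, 0)} = rect w h - H - ?B - {(0, h - 1), (w - 1, h - 1), (w - 1, 0)}"
    by (auto simp: Z_def TR_def)
  ultimately show ?thesis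
    using wh by (intro frame_trim(2)[OF frm, of "{(0, h - 1), (w - 1, h - 1), (w - 1, 0)}"]) auto
qed


section \<open>Doubling, and packings of every size\<close>

text \<open>Inverse of the halving step: the old pattern moves to the cells with two even
  coordinates, cells with two odd coordinates become holes, and those of mixed parity become tiles.
  A mixed cell lies between the doubles of two adjacent cells, one of which is a tile, so the new
  tiles stay connected.\<close>

lemma scattered_double:
  assumes "scattered_packable (k + 1) (k + 1) C" "k \<ge> 1"
  shows "scattered_packable (2 * k + 1) (2 * k + 1) C"
proof -
  obtain Z H where P: "packing (k + 1) (k + 1) C Z H"
    and scat: "\<And>p q. p \<in> rect (k + 1) (k + 1) - Z \<Longrightarrow> q \<in> rect (k + 1) (k + 1) - Z \<Longrightarrow> \<not> adj p q"
    using assms unfolding scattered_packable_def by blast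
  let ?R = "rect (k + 1) (k + 1)" and ?R2 = "rect (2 * k + 1) (2 * k + 1)"
  have Z: "Z \<subseteq> ?R" "Z \<inter> H = {}" "conn Z" and H: "H \<subseteq> ?R" "\<And>p q. p \<in> H \<Longrightarrow> adj p q \<Longrightarrow> q \<in> Z"
    and C: "int (card (?R - Z - H)) = C" and eq: "3 * int (card H) + C = k * k"
    using P unfolding packing_def by auto
  define dbl :: "cell \<Rightarrow> cell" where "dbl = (\<lambda>(x, y). (2 * x, 2 * y))"
  have dbl_simp [simp]: "dbl (x, y) = (2 * x, 2 * y)" for x y by (simp add: dbl_def)
  have inj: "inj dbl" by (auto simp: inj_def dbl_def)
  have dbl_mem: "(2 * x, 2 * y) \<in> dbl ` X \<longleftrightarrow> (x, y) \<in> X" for x y X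
    using inj_image_mem_iff[OF inj, of "(x, y)" X] by simp
  have dbl_even: "even x \<and> even y" if "(x, y) \<in> dbl ` X" for x y X using that by (auto simp: dbl_def)
  define M where "M = {(x, y) \<in> ?R2. odd (x + y)}"
  define Odds where "Odds = {(x, y) \<in> ?R2. odd x \<and> odd y}"
  let ?Z = "M \<union> dbl ` Z" and ?H = "Odds \<union> dbl ` H"
  have dbl_R: "dbl ` ?R = {(x, y) \<in> ?R2. even x \<and> even y}"
  proof (intro equalityI subsetI)
    fix p assume "p \<in> {(x, y) \<in> ?R2. even x \<and> even y}"
    then obtain i j where "p = (2 * i, 2 * j)" "(2 * i, 2 * j) \<in> ?R2" by (auto elim!: evenE)
    then show "p \<in> dbl ` ?R" using dbl_mem[of i j ?R] by auto
  qed auto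
  have R2: "?R2 = M \<union> Odds \<union> dbl ` ?R" unfolding dbl_R by (auto simp: M_def Odds_def)
  have disj: "M \<inter> Odds = {}" "M \<inter> dbl ` X = {}" "Odds \<inter> dbl ` X = {}" for X
    using dbl_even[of _ _ X] by (auto simp: M_def Odds_def)
  have sub: "dbl ` Z \<subseteq> dbl ` ?R" "dbl ` H \<subseteq> dbl ` ?R" using Z H by blast+
  have "dbl ` Z \<inter> dbl ` H = {}" using Z(2) inj by (simp add: image_Int[symmetric])
  then have disjZH: "?Z \<inter> ?H = {}" using disj(1) disj(2)[of H] disj(3)[of Z] by blast
  have "?R2 - ?Z - ?H = dbl ` ?R - dbl ` Z - dbl ` H"
    unfolding R2 using disj(2)[of ?R] disj(3)[of ?R] by blast
  then have "?R2 - ?Z - ?H = dbl ` (?R - Z - H)" by (simp only: image_set_diff[OF inj])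
  then have C': "int (card (?R2 - ?Z - ?H)) = C"
    using C card_image[OF inj_on_subset[OF inj subset_UNIV]] by simp
  have cardH: "3 * int (card ?H) + C = (2 * k + 1 - 1) * (2 * k + 1 - 1)"
  proof -
    have "Odds = (\<lambda>(i, j). (2 * i + 1, 2 * j + 1)) ` ({0..<k} \<times> {0..<k})" (is "_ = ?f ` _")
    proof (intro equalityI subsetI)
      fix p assume "p \<in> Odds"
      then obtain x y where p: "p = (x, y)" "odd x" "odd y" "(x, y) \<in> ?R2" by (auto simp: Odds_def)
      then obtain i j where "x = 2 * i + 1" "y = 2 * j + 1" by (meson oddE)
      then show "p \<in> ?f ` ({0..<k} \<times> {0..<k})" using p by (intro image_eqI[of _ _ "(i, j)"]) auto
    qed (auto simp: Odds_def)
    then have "card Odds = nat k * nat k"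
      by (simp add: card_image inj_on_def card_cartesian_product)
    moreover have "finite Odds" by (rule finite_subset[of _ ?R2]) (auto simp: Odds_def)
    moreover have "finite (dbl ` H)" using finite_subset[OF H(1)] by simp
    ultimately have "card ?H = nat k * nat k + card H"
      using disj(3)[of H] card_image[OF inj_on_subset[OF inj subset_UNIV], of H] by (simp add: card_Un_disjoint)
    then show ?thesis using eq assms(2) by (simp add: algebra_simps)
  qed
  have nbr_M: "q \<in> M" if "p \<in> dbl ` X" "adj p q" "q \<in> ?R2" for p q X
  proof -
    obtain x y where p: "p = (x, y)" by (cases p)
    then have "even x" "even y" using dbl_even that(1) by blast+
    then show ?thesis using that(2,3) adj_neighbour_cases[of x y q] unfolding p by (auto simp: M_def)
  qed
  have mixed: "(\<exists>a b. a \<in> ?R \<and> b \<in> ?R \<and> adj a b \<and> adj p (dbl a) \<and> adj p (dbl b))" if "p \<in> M" for p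
  proof -
    obtain x y where p: "p = (x, y)" by (cases p)
    have xy: "0 \<le> x" "x \<le> 2 * k" "0 \<le> y" "y \<le> 2 * k" "odd (x + y)" using that unfolding p M_def by auto
    show ?thesis
    proof (cases "even x")
      case True
      then obtain i j where ij: "x = 2 * i" "y = 2 * j + 1" using xy(5) by (metis evenE oddE even_add)
      then show ?thesis using xy unfolding p
        by (intro exI[of _ "(i, j)"] exI[of _ "(i, j + 1)"]) auto
    next
      case False
      then obtain i j where ij: "x = 2 * i + 1" "y = 2 * j" using xy(5) by (metis evenE oddE even_add)
      then show ?thesis using xy unfolding p
        by (intro exI[of _ "(i, j)"] exI[of _ "(i + 1, j)"]) auto
    qed
  qed
  have conn': "conn ?Z"
  proof (rule conn_if_closed_full)
    fix Q assume Q: "Q \<subseteq> ?Z" "Q \<noteq> {}" and closed: "\<And>a b. a \<in> Q \<Longrightarrow> b \<in> ?Z \<Longrightarrow> adj a b \<Longrightarrow> b \<in> Q"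
    have M_end: "\<exists>a\<in>Z. adj p (dbl a)" if "p \<in> M" for p using mixed[OF that] scat by blast
    obtain z where z: "z \<in> Z" "dbl z \<in> Q"
    proof -
      obtain p where p: "p \<in> Q" using Q(2) by blast
      then consider "p \<in> M" | a where "a \<in> Z" "p = dbl a" using Q(1) by blast
      then show ?thesis
      proof cases
        case 1
        then obtain a where "a \<in> Z" "adj p (dbl a)" using M_end by blast
        then show ?thesis using that closed[OF p] by blast
      qed (use that p in blast)
    qed
    have "Z \<subseteq> {a. dbl a \<in> Q}"
    proof (rule conn_subset[OF Z(3) z(1)])
      show "z \<in> {a. dbl a \<in> Q}" using z(2) by simp
      fix a b assume ab: "a \<in> {a. dbl a \<in> Q}" "a \<in> Z" "b \<in> Z" "adj a b"
      obtain x y u v where xy: "a = (x, y)" "b = (u, v)" by (cases a, cases b)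
      \<comment> \<open>The midpoint of the two doubled cells.\<close>
      have "(x + u, y + v) \<in> M" "adj (dbl a) (x + u, y + v)" "adj (x + u, y + v) (dbl b)"
        using ab(4) Z(1) ab(2,3) unfolding xy M_def by (auto simp: abs_if split: if_splits) (presburger+)?
      then have "dbl b \<in> Q" using closed ab by blast
      then show "b \<in> {a. dbl a \<in> Q}" by simp
    qed
    then have "dbl ` Z \<subseteq> Q" by blast
    moreover have "M \<subseteq> Q"
    proof
      fix p assume p: "p \<in> M"
      then obtain a where "a \<in> Z" "adj p (dbl a)" using M_end by blast
      then show "p \<in> Q" using closed[of "dbl a" p] \<open>dbl ` Z \<subseteq> Q\<close> p adj_sym by blast
    qed
    ultimately show "Q = ?Z" using Q(1) by blast
  qed
  have nbrs: "q \<in> ?Z" if p: "p \<in> ?H" "adj p q" for p q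
  proof -
    obtain x y u v where xy: "p = (x, y)" "q = (u, v)" by (cases p, cases q)
    have par: "even (x + y)" using p(1) dbl_even[of x y H] unfolding xy Odds_def by auto
    have "odd (u + v)" using par p(2) unfolding xy by (auto simp: abs_if split: if_splits) presburger+
    moreover have "1 \<le> x \<and> x \<le> 2 * k - 1 \<and> 1 \<le> y \<and> y \<le> 2 * k - 1"
    proof (cases "p \<in> Odds")
      case True
      then have "0 \<le> x" "x \<le> 2 * k" "0 \<le> y" "y \<le> 2 * k" "odd x" "odd y" unfolding xy Odds_def by auto
      then show ?thesis by presburger
    next
      case False
      then obtain i j where ij: "(i, j) \<in> H" "x = 2 * i" "y = 2 * j" using p(1) unfolding xy by auto
      have "(i + 1, j) \<in> ?R" "(i - 1, j) \<in> ?R" "(i, j + 1) \<in> ?R" "(i, j - 1) \<in> ?R"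
        using H(2)[OF ij(1)] Z(1) by (auto simp del: mem_rect)
      then show ?thesis using ij by auto
    qed
    ultimately show ?thesis using p(2) unfolding xy M_def by auto
  qed
  have "?Z \<subseteq> ?R2" "?H \<subseteq> ?R2" using sub R2 by blast+
  then have "packing (2 * k + 1) (2 * k + 1) C ?Z ?H"
    unfolding packing_def using disjZH conn' nbrs C' cardH by blast
  moreover have "\<not> adj p q" if "p \<in> ?R2 - ?Z" "q \<in> ?R2 - ?Z" for p q
  proof -
    obtain x y u v where xy: "p = (x, y)" "q = (u, v)" by (cases p, cases q)
    have "even (x + y)" "even (u + v)" using that unfolding xy M_def by auto
    then show ?thesis unfolding xy by (auto simp: abs_if split: if_splits) presburger+
  qed
  ultimately show ?thesis unfolding scattered_packable_def by blast
qed

text \<open>Doubling starts from the 2 by 2 square with three tiles and no hole, whose deficit is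
  1.\<close>

lemma scattered_power_of_two: "scattered_packable (2 ^ l + 1) (2 ^ l + 1) 1"
proof (induction l)
  case 0
  have "conn (set [(1, 0), (1, 1), (0 :: int, 1 :: int)])" by (rule conn_linked) simp
  moreover have R: "rect 2 2 = {(0, 0), (1, 0), (1, 1), (0, 1)}"
  proof -
    have "{0..<2} = {0, 1 :: int}" by auto
    then show ?thesis by (auto simp: rect_def)
  qed
  ultimately have "packing 2 2 1 {(1, 0), (1, 1), (0, 1)} {}"
    by (simp add: packing_def insert_Diff_if)
  then show ?case unfolding scattered_packable_def by (fastforce simp: R)
next
  case (Suc l)
  then show ?case using scattered_double[OF Suc] by simp
qed

text \<open>Even sides grow from the 4 by 4 frame in steps of six. Odd sides come from doubling,
  which preserves the residue: 3 divides \<open>n - 1\<close> if and only if it divides half of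
  it.\<close>

lemma scattered_square_three:
  assumes "n \<ge> 4" "n mod 3 = (1 :: nat)"
  shows "scattered_packable (int n) (int n) 3"
  using assms
proof (induction n rule: less_induct)
  case (less n)
  show ?case
  proof (cases "even n")
    case True
    define i where "i = (n - 4) div 6"
    have n: "n = 4 + 6 * i" using less.prems True unfolding i_def by presburger
    have "framed (4 + 6 * int i) (4 + 3 * int (2 * i)) 0 {(0, 0)} {} 3"
      using framed_grow[OF framed_4_4, of i "2 * i"] by simp
    then show ?thesis using framed_packable(2) unfolding n by simp
  next
    case False
    define k where "k = (n - 1) div 2"
    have k: "n = 2 * k + 1" "k + 1 \<ge> 4" "(k + 1) mod 3 = 1" "k + 1 < n"
      using less.prems False unfolding k_def by presburger+
    then have "scattered_packable (int k + 1) (int k + 1) 3" using less.IH[of "k + 1"] by (simp add: add.commute)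
    then show ?thesis using scattered_double[of "int k" 3] k by (simp add: add.commute)
  qed
qed

lemma scattered_square_four:
  assumes "n \<ge> 6" "n mod 3 \<noteq> (1 :: nat)" "\<nexists>l. l \<ge> 1 \<and> n = 2 ^ l + 1"
  shows "scattered_packable (int n) (int n) 4"
  using assms
proof (induction n rule: less_induct)
  case (less n)
  show ?case
  proof (cases "even n")
    case True
    have "\<exists>i. n = 6 + 6 * i \<or> n = 8 + 6 * i" using less.prems(1,2) True by presburger
    then obtain i where n: "n = 6 + 6 * i \<or> n = 8 + 6 * i" by blast
    have "framed (6 + 6 * int i) (6 + 3 * int (2 * i)) 0 {(0, 0)} {(1, 2), (2, 1), (2, 2)} 4"
      "framed (8 + 6 * int i) (8 + 3 * int (2 * i)) 0 {(0, 0)} {(1, 2), (2, 1), (2, 2)} 4"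
      using framed_grow[OF framed_6_6, of i "2 * i"] framed_grow[OF framed_8_8, of i "2 * i"] by simp_all
    from this[THEN framed_packable_four] n show ?thesis by auto
  next
    case False
    define k where "k = (n - 1) div 2"
    have k: "n = 2 * k + 1" "(k + 1) mod 3 \<noteq> 1" "k + 1 < n" "k \<ge> 3"
      using less.prems(1,2) False unfolding k_def by presburger+
    have pow: "\<nexists>l. l \<ge> 1 \<and> k + 1 = 2 ^ l + 1"
    proof
      assume "\<exists>l. l \<ge> 1 \<and> k + 1 = 2 ^ l + 1"
      then obtain l where "k = 2 ^ l" by auto
      then have "n = 2 ^ Suc l + 1" using k by simp
      then show False using less.prems(3) by auto
    qed
    \<comment> \<open>Halving could leave the range of sides at least 6 only at \<open>n = 7\<close>
      and \<open>n = 9\<close>; the former is 1 modulo 3, the latter is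
      \<open>2 ^ 3 + 1\<close>.\<close>
    have "k \<noteq> 3" using k(2) by auto
    moreover have "k \<noteq> 4" using pow by (auto dest!: spec[of _ 2])
    ultimately have "k + 1 \<ge> 6" using k(4) by simp
    then have "scattered_packable (int k + 1) (int k + 1) 4"
      using less.IH[OF k(3) _ k(2) pow] by (simp add: add.commute)
    then show ?thesis using scattered_double[of "int k" 4] k by (simp add: add.commute)
  qed
qed

text \<open>In each residue class modulo 6 the even one of the sides \<open>n\<close> and
  \<open>n + 1\<close> serves as width, so that the last growth by rows can reach the odd side. If
  the even side is \<open>n\<close>, the result is swapped.\<close>

lemma packable_rectangle_three:
  assumes "n \<ge> 6" "n mod 3 \<noteq> (2 :: nat)"
  shows "packable (int n + 1) (int n) 3"
proof -
  have pk: "packable w h 3" if "framed w h 0 {(0, 0)} {} 3" "even w" for w h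
    using framed_packable(1)[OF that] by simp
  have "\<exists>i. n = 6 + 6 * i \<or> n = 9 + 6 * i \<or> n = 10 + 6 * i \<or> n = 7 + 6 * i" using assms by presburger
  then obtain i where "n = 6 + 6 * i \<or> n = 9 + 6 * i \<or> n = 10 + 6 * i \<or> n = 7 + 6 * i" by blast
  then consider "n = 6 + 6 * i" | "n = 9 + 6 * i" | "n = 10 + 6 * i" | "n = 7 + 6 * i" by blast
  then show ?thesis
  proof cases
    case 1
    have "packable (6 + 6 * int i) (4 + 3 * int (1 + 2 * i)) 3"
      using framed_grow[OF framed_6_4, of i "1 + 2 * i"] by (intro pk) simp_all
    from packable_swap[OF this] show ?thesis unfolding 1 by (simp add: algebra_simps)
  next
    case 2
    have "packable (4 + 6 * int (i + 1)) (6 + 3 * int (1 + 2 * i)) 3"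
      using framed_grow[OF framed_swap[OF framed_6_4], of "i + 1" "1 + 2 * i"] by (intro pk) simp_all
    then show ?thesis unfolding 2 by (simp add: algebra_simps)
  next
    case 3
    have "packable (4 + 6 * int (i + 1)) (8 + 3 * int (1 + 2 * i)) 3"
      using framed_grow[OF framed_swap[OF framed_8_4], of "i + 1" "1 + 2 * i"] by (intro pk) simp_all
    from packable_swap[OF this] show ?thesis unfolding 3 by (simp add: algebra_simps)
  next
    case 4
    have "packable (8 + 6 * int i) (4 + 3 * int (1 + 2 * i)) 3"
      using framed_grow[OF framed_8_4, of i "1 + 2 * i"] by (intro pk) simp_all
    then show ?thesis unfolding 4 by (simp add: algebra_simps)
  qed
qed

lemma packable_rectangle_five:
  assumes "n \<ge> 6" "n mod 3 = (2 :: nat)"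
  shows "packable (int n + 1) (int n) 5"
proof -
  have "\<exists>i. n = 8 + 6 * i \<or> n = 11 + 6 * i" using assms by presburger
  then obtain i where "n = 8 + 6 * i \<or> n = 11 + 6 * i" by blast
  then consider "n = 8 + 6 * i" | "n = 11 + 6 * i" by blast
  then show ?thesis
  proof cases
    case 1
    have "packable (8 + 6 * int i) (6 + 3 * int (1 + 2 * i)) 5"
      using framed_packable(1)[OF framed_grow[OF framed_8_6, of i "1 + 2 * i"]] by simp
    from packable_swap[OF this] show ?thesis unfolding 1 by (simp add: algebra_simps)
  next
    case 2
    have "packable (6 + 6 * int (i + 1)) (8 + 3 * int (1 + 2 * i)) 5"
      using framed_packable(1)[OF framed_grow[OF framed_swap[OF framed_8_6], of "i + 1" "1 + 2 * i"]] by simp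
    then show ?thesis unfolding 2 by (simp add: algebra_simps)
  qed
qed

section \<open>Comparison of the bounds with the packings\<close>

lemma polyomino_hole_grid:
  assumes "polyomino A" "A \<subseteq> rect w h"
  obtains H where "hole_grid w h H" "card H = holes A"
proof -
  have A: "finite A" "A \<noteq> {}" "conn A" using assms(1) by (auto simp: polyomino_iff)
  obtain K where K: "hole_family A K" "card K = holes A" using holes_family[OF A(1)] by metis
  show ?thesis using hole_grid_of_family[OF assms(2) A(3,2) K(1)] that K(2) by metis
qed

lemma packing_holes:
  assumes "packing w h C Z H" "w \<ge> 1" "h \<ge> 1" "3 * int (card H) \<ge> 1"
  shows "polyomino Z" "card H \<le> holes Z" "int (card Z) = w * h - int (card H) - C"
proof -
  have P: "Z \<subseteq> rect w h" "H \<subseteq> rect w h" "Z \<inter> H = {}" "conn Z" "\<And>p q. p \<in> H \<Longrightarrow> adj p q \<Longrightarrow> q \<in> Z"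
    "int (card (rect w h - Z - H)) = C" using assms(1) unfolding packing_def by auto
  have fin: "finite Z" "finite H" using P(1,2) finite_rect finite_subset by blast+
  have "H \<noteq> {}" using assms(4) by (intro notI) simp
  then obtain x y where xy: "(x, y) \<in> H" by auto
  have "(x + 1, y) \<in> Z" by (rule P(5)[OF xy]) simp
  then show "polyomino Z" using fin P(4) by (auto simp: polyomino_iff)
  show "card H \<le> holes Z" using fin P(3,5) by (intro card_isolated_le_holes) auto
  have "rect w h = (rect w h - Z - H) \<union> (Z \<union> H)" using P(1,2) by blast
  moreover have "card ((rect w h - Z - H) \<union> (Z \<union> H)) = card (rect w h - Z - H) + card (Z \<union> H)"
    using fin by (intro card_Un_disjoint) auto
  ultimately have "card (rect w h) = card (rect w h - Z - H) + card (Z \<union> H)" by simp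
  moreover have "card (Z \<union> H) = card Z + card H" using fin P(3) by (rule card_Un_disjoint)
  moreover have "int (card (rect w h)) = w * h" using assms(2,3) by (simp add: rect_def card_cartesian_product)
  ultimately show "int (card Z) = w * h - int (card H) - C" using P(6) by simp
qed

text \<open>The bounding box of a smaller polyomino with as many holes would have sides \<open>a\<close> and \<open>b\<close> with
  \<open>(a - 1) * (b - 1) \<ge> (w - 1) * (h - 1) - C\<close> but with \<open>a + b < w + h\<close>; for nearly equal
  \<open>w\<close> and \<open>h\<close> this contradicts the inequality of arithmetic and geometric means.\<close>

lemma g_hmax_eq:
  fixes w h :: nat and C :: int
  assumes wh: "h \<ge> 6" "w = h \<or> w = h + 1" and C: "0 \<le> C" "C < int h - 1"
    and pack: "packable (int w) (int h) C"
    and upper: "\<And>H. hole_grid (int w) (int h) H \<Longrightarrow> 3 * int (card H) + C \<le> (int w - 1) * (int h - 1)"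
  shows "int (g (hmax w h)) = int (w * h) - int (hmax w h) - C"
proof -
  obtain Z H where P: "packing (int w) (int h) C Z H" using pack by (auto simp: packable_def)
  then have eq: "3 * int (card H) + C = (int w - 1) * (int h - 1)" by (simp add: packing_def)
  have "5 * (int h - 1) \<le> (int w - 1) * (int h - 1)" using wh by (intro mult_right_mono) auto
  moreover have "5 * (int h - 1) \<ge> int h" using wh(1) by simp
  ultimately have "(int w - 1) * (int h - 1) \<ge> int h" by (rule order_trans[rotated])
  then have pos: "3 * int (card H) \<ge> 1" unfolding eq[symmetric] using C by linarith
  have "1 \<le> int w" "1 \<le> int h" using wh by auto
  note Z = packing_holes[OF P this pos]
  have le: "holes A \<le> card H" if A: "polyomino A" "A \<subseteq> rect (int w) (int h)" for A
  proof -
    obtain H' where "hole_grid (int w) (int h) H'" "card H' = holes A" by (rule polyomino_hole_grid[OF A])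
    then show ?thesis using upper[of H'] eq by simp
  qed
  have Z': "Z \<subseteq> rect (int w) (int h)" using P by (simp add: packing_def)
  have holesZ: "holes Z = card H" using Z(1,2) le[OF _ Z'] wh by fastforce
  have "hmax w h = card H"
    unfolding hmax_def
  proof (rule Max_eqI)
    have "{holes A | A. polyomino A \<and> A \<subseteq> {0..<int w} \<times> {0..<int h}} \<subseteq> holes ` Pow (rect (int w) (int h))"
      by (auto simp: rect_def)
    then show "finite {holes A | A. polyomino A \<and> A \<subseteq> {0..<int w} \<times> {0..<int h}}"
      by (rule finite_subset) simp
    show "y \<le> card H" if "y \<in> {holes A | A. polyomino A \<and> A \<subseteq> {0..<int w} \<times> {0..<int h}}" for y
      using that le unfolding rect_def by blast
    show "card H \<in> {holes A | A. polyomino A \<and> A \<subseteq> {0..<int w} \<times> {0..<int h}}"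
      using Z(1) Z' holesZ wh unfolding rect_def by force
  qed
  moreover have "g (card H) = card Z"
    unfolding g_def
  proof (rule Least_equality)
    show "\<exists>A. polyomino A \<and> holes A = card H \<and> card A = card Z" using Z(1) holesZ wh by force
    fix n assume "\<exists>A. polyomino A \<and> holes A = card H \<and> card A = n"
    then obtain A where A: "polyomino A" "holes A = card H" "card A = n" by blast
    then have A': "finite A" "A \<noteq> {}" "conn A" by (auto simp: polyomino_iff)
    obtain K where K: "hole_family A K" "card K = card H" using holes_family[OF A'(1)] A(2) by metis
    define a b where "a = int (card (fst ` A))" and "b = int (card (snd ` A))"
    have 1: "2 * int (card H) + a + b \<le> int n + 1"
      using hole_family_card_bound[OF A'(1,3,2) K(1)] K(2) A(3) unfolding a_def b_def by linarith
    have "card A + card K \<le> card (fst ` A) * card (snd ` A)" by (rule hole_family_area_bound[OF A'(1) K(1)])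
    then have 2: "int n + int (card H) \<le> a * b"
      using K(2) A(3) unfolding a_def b_def by (metis of_nat_add of_nat_le_iff of_nat_mult)
    show "card Z \<le> n"
    proof (rule ccontr)
      assume "\<not> card Z \<le> n"
      then have small: "int n + 1 \<le> int w * int h - int (card H) - C" using Z(3) wh by simp
      \<comment> \<open>Both estimates are free of \<open>n\<close>: \<open>small\<close> bounds it
        from above in \<open>1\<close>, and \<open>1\<close> and \<open>2\<close> enclose
        it.\<close>
      have sum: "a + b \<le> int w + int h - 1" using 1 small eq by (simp add: algebra_simps)
      have prod: "(int w - 1) * (int h - 1) - C \<le> (a - 1) * (b - 1)" using 1 2 eq by (simp add: algebra_simps)
      have "4 * ((int w - 1) * (int h - 1) - C) \<le> 4 * ((a - 1) * (b - 1))"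
        using prod by (intro mult_left_mono) auto
      also have "\<dots> \<le> (a + b - 2)\<^sup>2"
        using zero_le_power2[of "a - b"] by (simp add: power2_eq_square algebra_simps)
      also have "\<dots> \<le> (int w + int h - 3)\<^sup>2"
      proof (rule power_mono)
        have "finite (fst ` A)" "fst ` A \<noteq> {}" "finite (snd ` A)" "snd ` A \<noteq> {}" using A' by auto
        then have "a \<ge> 1" "b \<ge> 1" unfolding a_def b_def by (simp_all add: Suc_le_eq card_gt_0_iff)
        then show "0 \<le> a + b - 2" by simp
      qed (use sum in simp)
      finally have "4 * ((int w - 1) * (int h - 1) - C) \<le> (int w + int h - 3)\<^sup>2" .
      \<comment> \<open>The left side exceeds the right one by \<open>4 * (h - 1 - C) - 1\<close> if
        \<open>w = h\<close>, and by \<open>4 * (h - 1 - C)\<close> if \<open>w = h + 1\<close>;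
        both are positive.\<close>
      then show False using wh(2) C by (auto simp: power2_eq_square algebra_simps)
    qed
  qed
  ultimately show ?thesis using Z(3) wh by simp
qed

text \<open>The deficit is congruent to the square of \<open>n - 1\<close> modulo 3, that is, to 0
  if \<open>n\<close> is 1 modulo 3 and to 1 otherwise. As 0 never occurs, and 1 only if
  \<open>n - 1\<close> is a power of two, the next candidates are 3 and 4.\<close>

lemma square_holes_upper:
  assumes "n \<ge> 6" "hole_grid (int n) (int n) H"
  shows "3 * int (card H) + (if \<exists>l\<ge>1. n = 2 ^ l + 1 then 1 else if n mod 3 = 1 then 3 else 4) \<le> (int n - 1) * (int n - 1)"
proof -
  have pos: "3 * int (card H) + 1 \<le> (int n - 1) * (int n - 1)"
    using assms by (intro hole_grid_deficit_pos) auto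
  have ne: "3 * int (card H) + 1 \<noteq> (int n - 1) * (int n - 1)" if nl: "\<nexists>l. l \<ge> 1 \<and> n = 2 ^ l + 1"
  proof
    assume eq: "3 * int (card H) + 1 = (int n - 1) * (int n - 1)"
    have "\<exists>k. n - 1 = 2 ^ k"
      by (rule hole_grid_square_power_of_two[of _ H]) (use assms eq in \<open>simp_all add: of_nat_diff\<close>)
    then obtain k where k: "n - 1 = 2 ^ k" by blast
    then have "n = 2 ^ k + 1" "k \<ge> 1" using assms(1) by (simp, cases k, simp_all)
    then show False using nl by blast
  qed
  obtain r q where n: "int n - 1 = 3 * q + r" "r \<in> {0, 1, 2}" "r = (int n - 1) mod 3"
  proof
    show "int n - 1 = 3 * ((int n - 1) div 3) + (int n - 1) mod 3" by simp
    show "(int n - 1) mod 3 \<in> {0, 1, 2}" by auto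
  qed simp
  have sq: "(int n - 1) * (int n - 1) = 3 * (3 * q * q + 2 * q * r) + r * r"
    unfolding n(1) by (simp add: algebra_simps)
  define t where "t = 3 * q * q + 2 * q * r"
  have cases: "(n mod 3 = 1 \<and> r = 0) \<or> (n mod 3 \<noteq> 1 \<and> (r = 1 \<or> r = 2))"
    using n(2,3) assms(1) by (auto; presburger)
  show ?thesis
    using pos ne cases unfolding sq t_def[symmetric] by (auto; presburger)
qed

text \<open>Modulo 3 the product \<open>n * (n - 1)\<close> is 2 if \<open>n\<close> is 2, and 0
  otherwise. One of the sides \<open>n\<close> and \<open>n + 1\<close> is even, which excludes the
  deficit 2; the next candidates are 3 and 5.\<close>

lemma rectangle_holes_upper:
  assumes "n \<ge> 6" "hole_grid (int (n + 1)) (int n) H"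
  shows "3 * int (card H) + (if n mod 3 \<noteq> 2 then 3 else 5) \<le> (int (n + 1) - 1) * (int n - 1)"
proof -
  have pos: "3 * int (card H) + 1 \<le> (int (n + 1) - 1) * (int n - 1)"
    using assms by (intro hole_grid_deficit_pos) auto
  have ne: "3 * int (card H) + 2 \<noteq> (int (n + 1) - 1) * (int n - 1)"
  proof (cases "even n")
    case False
    then show ?thesis using assms by (intro hole_grid_deficit_even) auto
  next
    case True
    have "card (prod.swap ` H) = card H" by (simp add: card_image)
    moreover have "3 * int (card (prod.swap ` H)) + 2 \<noteq> (int n - 1) * (int (n + 1) - 1)"
      using True assms hole_grid_swap[OF assms(2)] by (intro hole_grid_deficit_even) auto
    ultimately show ?thesis by (simp add: mult.commute)
  qed
  define q where "q = int n div 3"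
  define r where "r = int n mod 3"
  have n: "int n = 3 * q + r" "r = 0 \<or> r = 1 \<or> r = 2" unfolding q_def r_def by (simp, presburger)
  have sq: "(int (n + 1) - 1) * (int n - 1) = 3 * (3 * q * q + 2 * q * r - q) + r * (r - 1)"
    using n(1) by (simp add: algebra_simps)
  define t where "t = 3 * q * q + 2 * q * r - q"
  have "n mod 3 = 2 \<longleftrightarrow> r = 2" unfolding r_def by presburger
  then show ?thesis
    using pos ne n(2) unfolding sq t_def[symmetric] by (auto; presburger)
qed

theorem theorem2:
  fixes N \<alpha> :: nat
  assumes "N \<ge> 6"
    and "\<alpha> \<in> {N^2, N * (N + 1)}"
  shows "int (g (h_alpha N \<alpha>)) = int \<alpha> - int (h_alpha N \<alpha>) - C_const N \<alpha>"
proof (cases "\<alpha> = N^2")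
  case True
  define C :: int where "C = (if \<exists>l\<ge>1. N = 2 ^ l + 1 then 1 else if N mod 3 = 1 then 3 else 4)"
  have "packable (int N) (int N) C"
  proof (cases "\<exists>l\<ge>1. N = 2 ^ l + 1")
    case True
    then obtain l where l: "N = 2 ^ l + 1" by blast
    have "scattered_packable (int N) (int N) 1" using scattered_power_of_two[of l] l by (simp add: add.commute)
    moreover have "C = 1" using True by (simp add: C_def)
    ultimately show ?thesis using scattered_imp_packable by simp
  next
    case False
    then show ?thesis
      using scattered_square_three[of N] scattered_square_four[of N] scattered_imp_packable assms(1)
      by (auto simp: C_def)
  qed
  moreover have "0 \<le> C" "C < int N - 1" using assms(1) by (auto simp: C_def)
  ultimately have "int (g (hmax N N)) = int (N * N) - int (hmax N N) - C"
    using assms(1) square_holes_upper[OF assms(1)] by (intro g_hmax_eq) (auto simp: C_def)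
  moreover have "C_const N \<alpha> = C" using True by (simp add: C_const_def C_def)
  ultimately show ?thesis using True by (simp add: h_alpha_def power2_eq_square)
next
  case False
  then have \<alpha>: "\<alpha> = (N + 1) * N" using assms(2) by (simp add: mult.commute)
  define C :: int where "C = (if N mod 3 \<noteq> 2 then 3 else 5)"
  have "packable (int (N + 1)) (int N) C"
    using packable_rectangle_three[OF assms(1)] packable_rectangle_five[OF assms(1)]
    by (auto simp: C_def add.commute)
  moreover have "0 \<le> C" "C < int N - 1"
  proof -
    \<comment> \<open>\<open>C = 5\<close> needs \<open>N > 6\<close> in \<open>C < N - 1\<close>;
      the first admissible \<open>N\<close> with remainder 2 is 8.\<close>
    have "N \<ge> 8" if "N mod 3 = 2" using that assms(1) by presburger
    then show "0 \<le> C" "C < int N - 1" using assms(1) by (auto simp: C_def)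
  qed
  ultimately have "int (g (hmax (N + 1) N)) = int ((N + 1) * N) - int (hmax (N + 1) N) - C"
    using assms(1) rectangle_holes_upper[OF assms(1)] by (intro g_hmax_eq) (auto simp: C_def)
  moreover have "C_const N \<alpha> = C" using False by (simp add: C_const_def C_def)
  ultimately show ?thesis using False \<alpha> by (simp add: h_alpha_def)
qed

end
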